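(* Let $G$ be a Cayley bigraph on a finite group $\mathcal G$, $L$ a subgraph of $G$ (coloured as in $G$), and $\mathbb F$ a field. Suppose there is a short exact sequence of sheaves on $G$ $$0\to\mathcal K\to\bigoplus_{x\in\mathcal G}\underline{\mathbb F}_{Lx}\to\underline{\mathbb F}^{\rho(L)}\to0$$ with ${\rm m.e.}(\mathcal K)=0$. Then for every étale bigraph $L'$, $\rho(L\times_{B_2}L')\le\rho(L)\rho(L')$.
   Context: A digraph has finite vertex/edge sets with tail/head maps. A bigraph is a digraph with edges coloured $1$ or $2$; it is étale if no vertex is the head of two distinct edges of the same colour or the tail of two distinct edges of the same colour. $K\times_{B_2}L$: vertices $V_K\times V_L$, edges pairs $(e_1,e_2)$ of the same colour, tail $(te_1,te_2)$, head $(he_1,he_2)$. Cayley bigraph on $\mathcal G$ with generators $g_1,g_2$: $V=\mathcal G$, $E=\mathcal G\times\{1,2\}$, edge $(g,i)$ of colour $i$ with tail $g$ and head $g_ig$. For $x\in\mathcal G$, $Lx$ is the image of $L$ under the automorphism $g\mapsto gx$, $(g,i)\mapsto(gx,i)$. For a subgraph $H$, $\underline{\mathbb F}_H$ is the sheaf with value $\mathbb F$ on vertices and edges of $H$ and $0$ elsewhere, restriction maps the identity when both ends are $\mathbb F$ and $0$ otherwise; $\underline{\mathbb F}$ is the constant sheaf with value $\mathbb F$ everywhere and identity restriction maps. Sheaves, morphisms (linear maps on values commuting with restriction maps), exactness (valuewise) and maximum excess: a sheaf $\mathcal F$ has spaces $\mathcal F(P)$ and maps $\mathcal F(t,e),\mathcal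 F(h,e)$; with $\mathcal F(V)=\bigoplus_v\mathcal F(v)$, $\mathcal F(E)=\bigoplus_e\mathcal F(e)$, $d_h,d_t$ sending $\mathcal F(e)$ into $\mathcal F(h e)$, $\mathcal F(te)$; $\Gamma_{\rm ht}(U)=\bigoplus_e\{w\in\mathcal F(e):d_hw,d_tw\in U\}$, ${\rm m.e.}(\mathcal F)=\max_{U\subset\mathcal F(V)}(\dim\Gamma_{\rm ht}(U)-\dim U)$. $\rho$ is reduced cyclicity: $\rho(H)=\sum_X\max(0,|E_X|-|V_X|)$ over connected components $X$ of the underlying undirected graph. *)

theory Defs
  imports Complex_Main "HOL-Library.Function_Algebras" "HOL-Algebra.Group"
begin

text \<open>Every vector space value of a sheaf is modelled as a subspace of the
pointwise vector space of functions 'i => 'k (for an arbitrary index type 'i).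
Every finite-dimensional 'k-vector space is isomorphic to such a subspace.\<close>

definition fscale :: "'k::field \<Rightarrow> ('i \<Rightarrow> 'k) \<Rightarrow> ('i \<Rightarrow> 'k)" where
  "fscale c f = (\<lambda>i. c * f i)"

definition fsubspace :: "('i \<Rightarrow> 'k::field) set \<Rightarrow> bool" where
  "fsubspace S = module.subspace fscale S"

definition fin_dim :: "('i \<Rightarrow> 'k::field) set \<Rightarrow> bool" where
  "fin_dim S = (\<exists>B. finite B \<and> B \<subseteq> S \<and> module.span fscale B = S)"

definition fdim :: "('i \<Rightarrow> 'k::field) set \<Rightarrow> nat" where
  "fdim S = vector_space.dim fscale S"

definition lin_on :: "('i \<Rightarrow> 'k::field) set \<Rightarrow> ('j \<Rightarrow> 'k) set \<Rightarrow> (('i \<Rightarrow> 'k) \<Rightarrow> ('j \<Rightarrow> 'k)) \<Rightarrow> bool" where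
  "lin_on S T f = ((\<forall>x\<in>S. f x \<in> T) \<and> (\<forall>x\<in>S. \<forall>y\<in>S. f (x + y) = f x + f y)
                   \<and> (\<forall>c. \<forall>x\<in>S. f (fscale c x) = fscale c (f x)))"

record ('v,'e) bigraph =
  bverts :: "'v set"
  barcs  :: "'e set"
  btail  :: "'e \<Rightarrow> 'v"
  bhead  :: "'e \<Rightarrow> 'v"
  bcol   :: "'e \<Rightarrow> nat"

definition wf_bigraph :: "('v,'e) bigraph \<Rightarrow> bool" where
  "wf_bigraph B = (finite (bverts B) \<and> finite (barcs B) \<and>
     (\<forall>e\<in>barcs B. btail B e \<in> bverts B \<and> bhead B e \<in> bverts B \<and> bcol B e \<in> {1,2}))"

definition etale :: "('v,'e) bigraph \<Rightarrow> bool" where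
  "etale B = (\<forall>e1\<in>barcs B. \<forall>e2\<in>barcs B. e1 \<noteq> e2 \<and> bcol B e1 = bcol B e2 \<longrightarrow>
                bhead B e1 \<noteq> bhead B e2 \<and> btail B e1 \<noteq> btail B e2)"

definition fprod :: "('v1,'e1) bigraph \<Rightarrow> ('v2,'e2) bigraph \<Rightarrow> ('v1 \<times> 'v2, 'e1 \<times> 'e2) bigraph" where
  "fprod K L = \<lparr> bverts = bverts K \<times> bverts L,
                 barcs = {(e1,e2). e1 \<in> barcs K \<and> e2 \<in> barcs L \<and> bcol K e1 = bcol L e2},
                 btail = (\<lambda>(e1,e2). (btail K e1, btail L e2)),
                 bhead = (\<lambda>(e1,e2). (bhead K e1, bhead L e2)),
                 bcol = (\<lambda>(e1,e2). bcol K e1) \<rparr>"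

definition conn_rel :: "('v,'e) bigraph \<Rightarrow> ('v \<times> 'v) set" where
  "conn_rel B = {(u,w). u \<in> bverts B \<and> w \<in> bverts B \<and>
      (u,w) \<in> ({(btail B e, bhead B e) | e. e \<in> barcs B} \<union> {(bhead B e, btail B e) | e. e \<in> barcs B})\<^sup>*}"

definition components :: "('v,'e) bigraph \<Rightarrow> 'v set set" where
  "components B = bverts B // conn_rel B"

definition rho :: "('v,'e) bigraph \<Rightarrow> nat" where
  "rho B = (\<Sum>X\<in>components B.
      nat (max 0 (int (card {e\<in>barcs B. btail B e \<in> X}) - int (card X))))"

definition is_subgraph :: "('v,'e) bigraph \<Rightarrow> ('v,'e) bigraph \<Rightarrow> bool" where
  "is_subgraph L B = (bverts L \<subseteq> bverts B \<and> barcs L \<subseteq> barcs B \<and>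
     (\<forall>e\<in>barcs L. btail L e = btail B e \<and> bhead L e = bhead B e \<and> bcol L e = bcol B e
                   \<and> btail L e \<in> bverts L \<and> bhead L e \<in> bverts L))"

definition cayley :: "('g,'a) monoid_scheme \<Rightarrow> 'g \<Rightarrow> 'g \<Rightarrow> ('g, 'g \<times> nat) bigraph" where
  "cayley G g1 g2 = \<lparr> bverts = carrier G, barcs = carrier G \<times> {1,2},
      btail = fst,
      bhead = (\<lambda>(g,i). (if i = 1 then g1 else g2) \<otimes>\<^bsub>G\<^esub> g),
      bcol = snd \<rparr>"

definition rtranslate :: "('g,'a) monoid_scheme \<Rightarrow> 'g \<Rightarrow> 'g \<Rightarrow> ('g, 'g \<times> nat) bigraph \<Rightarrow> 'g
                            \<Rightarrow> ('g, 'g \<times> nat) bigraph" where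
  "rtranslate G g1 g2 L x = (cayley G g1 g2)
      \<lparr> bverts := (\<lambda>g. g \<otimes>\<^bsub>G\<^esub> x) ` bverts L,
        barcs := (\<lambda>(g,i). (g \<otimes>\<^bsub>G\<^esub> x, i)) ` barcs L \<rparr>"

text \<open>Restriction maps go from the edge value to the vertex values:
 rt e : F(e) -> F(t e),  rh e : F(e) -> F(h e).\<close>
record ('v,'e,'i,'k) sheaf =
  sv :: "'v \<Rightarrow> ('i \<Rightarrow> 'k) set"
  se :: "'e \<Rightarrow> ('i \<Rightarrow> 'k) set"
  rt :: "'e \<Rightarrow> ('i \<Rightarrow> 'k) \<Rightarrow> ('i \<Rightarrow> 'k)"
  rh :: "'e \<Rightarrow> ('i \<Rightarrow> 'k) \<Rightarrow> ('i \<Rightarrow> 'k)"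

definition is_sheaf :: "('v,'e) bigraph \<Rightarrow> ('v,'e,'i,'k::field) sheaf \<Rightarrow> bool" where
  "is_sheaf B F = ((\<forall>v\<in>bverts B. fsubspace (sv F v) \<and> fin_dim (sv F v)) \<and>
     (\<forall>e\<in>barcs B. fsubspace (se F e) \<and> fin_dim (se F e) \<and>
        lin_on (se F e) (sv F (btail B e)) (rt F e) \<and>
        lin_on (se F e) (sv F (bhead B e)) (rh F e)))"

record ('v,'e,'i,'j,'k) sheaf_map =
  mv :: "'v \<Rightarrow> ('i \<Rightarrow> 'k) \<Rightarrow> ('j \<Rightarrow> 'k)"
  mE :: "'e \<Rightarrow> ('i \<Rightarrow> 'k) \<Rightarrow> ('j \<Rightarrow> 'k)"

definition is_morphism :: "('v,'e) bigraph \<Rightarrow> ('v,'e,'i,'k::field) sheaf \<Rightarrow> ('v,'e,'j,'k) sheaf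
                             \<Rightarrow> ('v,'e,'i,'j,'k) sheaf_map \<Rightarrow> bool" where
  "is_morphism B F G a = ((\<forall>v\<in>bverts B. lin_on (sv F v) (sv G v) (mv a v)) \<and>
     (\<forall>e\<in>barcs B. lin_on (se F e) (se G e) (mE a e) \<and>
        (\<forall>w\<in>se F e. rt G e (mE a e w) = mv a (btail B e) (rt F e w) \<and>
                    rh G e (mE a e w) = mv a (bhead B e) (rh F e w))))"

definition exact_at :: "('i \<Rightarrow> 'k::field) set \<Rightarrow> ('j \<Rightarrow> 'k) set \<Rightarrow> ('l \<Rightarrow> 'k) set
    \<Rightarrow> (('i \<Rightarrow> 'k) \<Rightarrow> ('j \<Rightarrow> 'k)) \<Rightarrow> (('j \<Rightarrow> 'k) \<Rightarrow> ('l \<Rightarrow> 'k)) \<Rightarrow> bool" where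
  "exact_at K A C a b = (inj_on a K \<and> a ` K = {x\<in>A. b x = 0} \<and> b ` A = C)"

definition short_exact :: "('v,'e) bigraph \<Rightarrow> ('v,'e,'i,'k::field) sheaf \<Rightarrow> ('v,'e,'j,'k) sheaf
    \<Rightarrow> ('v,'e,'l,'k) sheaf \<Rightarrow> ('v,'e,'i,'j,'k) sheaf_map \<Rightarrow> ('v,'e,'j,'l,'k) sheaf_map \<Rightarrow> bool" where
  "short_exact B K A C a b = (is_sheaf B K \<and> is_sheaf B A \<and> is_sheaf B C \<and>
     is_morphism B K A a \<and> is_morphism B A C b \<and>
     (\<forall>v\<in>bverts B. exact_at (sv K v) (sv A v) (sv C v) (mv a v) (mv b v)) \<and>
     (\<forall>e\<in>barcs B. exact_at (se K e) (se A e) (se C e) (mE a e) (mE b e)))"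

text \<open>F(V) = direct sum of the F(v), realised inside ('v x 'i) => 'k; similarly F(E).\<close>
definition totV :: "('v,'e) bigraph \<Rightarrow> ('v,'e,'i,'k::field) sheaf \<Rightarrow> ('v \<times> 'i \<Rightarrow> 'k) set" where
  "totV B F = {u. \<forall>v. (\<lambda>i. u (v,i)) \<in> (if v \<in> bverts B then sv F v else {0})}"

definition totE :: "('v,'e) bigraph \<Rightarrow> ('v,'e,'i,'k::field) sheaf \<Rightarrow> ('e \<times> 'i \<Rightarrow> 'k) set" where
  "totE B F = {w. \<forall>e. (\<lambda>i. w (e,i)) \<in> (if e \<in> barcs B then se F e else {0})}"

definition embV :: "'v \<Rightarrow> ('i \<Rightarrow> 'k::zero) \<Rightarrow> ('v \<times> 'i \<Rightarrow> 'k)" where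
  "embV v x = (\<lambda>(v',i). if v' = v then x i else 0)"

definition Gamma_ht :: "('v,'e) bigraph \<Rightarrow> ('v,'e,'i,'k::field) sheaf \<Rightarrow> ('v \<times> 'i \<Rightarrow> 'k) set
                          \<Rightarrow> ('e \<times> 'i \<Rightarrow> 'k) set" where
  "Gamma_ht B F U = {w \<in> totE B F. \<forall>e\<in>barcs B.
       embV (bhead B e) (rh F e (\<lambda>i. w (e,i))) \<in> U \<and>
       embV (btail B e) (rt F e (\<lambda>i. w (e,i))) \<in> U}"

definition max_excess :: "('v,'e) bigraph \<Rightarrow> ('v,'e,'i,'k::field) sheaf \<Rightarrow> int" where
  "max_excess B F = Max {int (fdim (Gamma_ht B F U)) - int (fdim U) | U.
                          fsubspace U \<and> U \<subseteq> totV B F}"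

definition ind_sheaf :: "('v,'e) bigraph \<Rightarrow> ('v,'e,unit,'k::field) sheaf" where
  "ind_sheaf H = \<lparr> sv = (\<lambda>v. if v \<in> bverts H then UNIV else {0}),
                   se = (\<lambda>e. if e \<in> barcs H then UNIV else {0}),
                   rt = (\<lambda>e w. if e \<in> barcs H \<and> btail H e \<in> bverts H then w else 0),
                   rh = (\<lambda>e w. if e \<in> barcs H \<and> bhead H e \<in> bverts H then w else 0) \<rparr>"

definition dsum :: "'x set \<Rightarrow> ('x \<Rightarrow> ('v,'e,'i,'k::field) sheaf) \<Rightarrow> ('v,'e,'x \<times> 'i,'k) sheaf" where
  "dsum X Fs = \<lparr> sv = (\<lambda>v. {f. \<forall>x. (\<lambda>i. f (x,i)) \<in> (if x \<in> X then sv (Fs x) v else {0})}),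
                 se = (\<lambda>e. {f. \<forall>x. (\<lambda>i. f (x,i)) \<in> (if x \<in> X then se (Fs x) e else {0})}),
                 rt = (\<lambda>e f (x,i). if x \<in> X then rt (Fs x) e (\<lambda>j. f (x,j)) i else 0),
                 rh = (\<lambda>e f (x,i). if x \<in> X then rh (Fs x) e (\<lambda>j. f (x,j)) i else 0) \<rparr>"

definition const_sheaf :: "nat \<Rightarrow> ('v,'e,nat,'k::field) sheaf" where
  "const_sheaf n = \<lparr> sv = (\<lambda>v. {f. \<forall>i\<ge>n. f i = 0}), se = (\<lambda>e. {f. \<forall>i\<ge>n. f i = 0}),
                     rt = (\<lambda>e w. w), rh = (\<lambda>e w. w) \<rparr>"

end

theory Submission
  imports Defs "HOL-Algebra.Bij"
begin

text \<open>
Only families of subspaces \<open>U v\<close> of the vertex values matter for the maximum excess, and on such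
families the excess is supermodular; hence there is a least family of maximal excess, and it is
invariant under all symmetries of the sheaf.  For a pullback to a product with a Cayley bigraph of a
group \<open>S\<close> this least family descends to the base, so the maximum excess is multiplied by
\<open>card S\<close>.  Taking for \<open>S\<close> the permutations of the vertices of \<open>L'\<close> shows that the pullback of
\<open>K\<close> along \<open>L'\<close> still has maximum excess 0; taking for \<open>S\<close> the given group bounds the
pullback of the constant sheaf by \<open>card G * rho L * rho L'\<close>.  Excess is subadditive along short
exact sequences, and the pullback of the sum of the translates of \<open>L\<close> has excess at least
\<open>card G * rho (fprod L L')\<close>, because each translate contributes a copy of \<open>fprod L L'\<close>.
\<close>

section \<open>Finite-dimensional subspaces of function spaces\<close>

text \<open>A maximizer on a covering has no reason to come from the base: an arbitrary one need not
  be invariant under deck transformations. A least maximizer is unique, hence fixed by all of them,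
  and on a Cayley covering they are the right translations: they commute with the left
  multiplications that define the arcs and act transitively on fibres. A product with an etale
  bigraph is in general neither a covering nor Galois, so this argument does not apply to it
  directly. Completing it to a covering keeps the vertices and adds arcs, which can only raise the
  excess, so an upper bound survives. The product of the Cayley bigraph with \<open>L'\<close> is
  read from two sides. For \<open>K\<close> the base is the Cayley bigraph; for the constant sheaf
  the base is \<open>L'\<close>, since that sheaf looks the same from either factor. Hence
  \<open>card (carrier G)\<close> arises both as a covering degree and as the number of translates,
  and cancels. The link with \<open>rho\<close> is that \<open>rho\<close> is the maximum, over
  vertex subsets, of the number of arcs inside minus the number of vertices. Pivot positions of
  subspaces reduce the constant sheaf to such subsets.\<close>

interpretation fs: vector_space "fscale :: 'k::field \<Rightarrow> ('i \<Rightarrow> 'k) \<Rightarrow> ('i \<Rightarrow> 'k)"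
  by unfold_locales (auto simp: fscale_def fun_eq_iff algebra_simps)

interpretation fsp: vector_space_pair
  "fscale :: 'k::field \<Rightarrow> ('i \<Rightarrow> 'k) \<Rightarrow> ('i \<Rightarrow> 'k)"
  "fscale :: 'k::field \<Rightarrow> ('j \<Rightarrow> 'k) \<Rightarrow> ('j \<Rightarrow> 'k)"
  by unfold_locales

lemma fsubspaceD:
  assumes "fsubspace S"
  shows "0 \<in> S" "\<And>x y. x \<in> S \<Longrightarrow> y \<in> S \<Longrightarrow> x + y \<in> S"
    "\<And>c x. x \<in> S \<Longrightarrow> fscale c x \<in> S"
  using assms by (auto simp: fsubspace_def fs.subspace_0 fs.subspace_add fs.subspace_scale)

lemma fsubspaceI:
  assumes "0 \<in> S" "\<And>x y. x \<in> S \<Longrightarrow> y \<in> S \<Longrightarrow> x + y \<in> S"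
    "\<And>c x. x \<in> S \<Longrightarrow> fscale c x \<in> S"
  shows "fsubspace S"
  unfolding fsubspace_def using assms by (rule fs.subspaceI)

lemma fsubspace_Int: "fsubspace A \<Longrightarrow> fsubspace B \<Longrightarrow> fsubspace (A \<inter> B)"
  by (auto simp: fsubspace_def fs.subspace_inter)

text \<open>The library gives an infinite-dimensional space dimension 0, because an infinite basis
  has \<open>card\<close> 0. Monotonicity and rank formulas therefore carry \<open>fin_dim\<close>
  along, and this lemma turns it into finite bases.\<close>

lemma fin_dim_basis:
  assumes "fin_dim S" "A \<subseteq> S"
  obtains B where "finite B" "B \<subseteq> A" "fs.independent B" "A \<subseteq> fs.span B" "card B = fdim A"
proof -
  obtain T where T: "finite T" "fs.span T = S"
    using assms(1) by (auto simp: fin_dim_def)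
  obtain B where B: "B \<subseteq> A" "fs.independent B" "A \<subseteq> fs.span B" "card B = fs.dim A"
    using fs.basis_exists by blast
  have "finite B"
    using fs.independent_span_bound[OF T(1) B(2)] B(1) T(2) assms(2) by blast
  with B show ?thesis
    by (intro that[of B]) (auto simp: fdim_def)
qed

lemma fin_dimI:
  assumes "finite B" "B \<subseteq> S" "S \<subseteq> fs.span B" "fsubspace S"
  shows "fin_dim S"
  using assms by (metis fin_dim_def fs.span_minimal fsubspace_def subset_antisym)

lemma fin_dim_subset:
  assumes "fin_dim S" "A \<subseteq> S" "fsubspace A"
  shows "fin_dim A"
  using fin_dim_basis[OF assms(1,2)] fin_dimI[OF _ _ _ assms(3)] by metis

lemma fdim_mono:
  assumes "fin_dim S" "A \<subseteq> S"
  shows "fdim A \<le> fdim S"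
proof -
  obtain B where B: "finite B" "B \<subseteq> A" "fs.independent B" "A \<subseteq> fs.span B" "card B = fdim A"
    using fin_dim_basis[OF assms] by blast
  obtain C where C: "finite C" "C \<subseteq> S" "fs.independent C" "S \<subseteq> fs.span C" "card C = fdim S"
    using fin_dim_basis[OF assms(1) order.refl] by blast
  show ?thesis
    using fs.independent_span_bound[OF C(1) B(3)] B C assms(2) by fastforce
qed

lemma fdim_eq_imp_eq:
  assumes "fin_dim S" "A \<subseteq> S" "fsubspace A" "fdim S \<le> fdim A"
  shows "A = S"
proof -
  obtain B where B: "finite B" "B \<subseteq> A" "fs.independent B" "A \<subseteq> fs.span B" "card B = fdim A"
    using fin_dim_basis[OF assms(1,2)] by blast
  obtain C where C: "B \<subseteq> C" "C \<subseteq> S" "fs.independent C" "S \<subseteq> fs.span C"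
    using fs.maximal_independent_subset_extend[of B S] B(2,3) assms(2) by blast
  obtain T where T: "finite T" "fs.span T = S"
    using assms(1) by (auto simp: fin_dim_def)
  have "finite C"
    using fs.independent_span_bound[OF T(1) C(3)] C(2) T(2) by blast
  moreover have "card C = fdim S"
    using C fs.basis_card_eq_dim by (auto simp: fdim_def)
  ultimately have "B = C"
    using C(1) B(5) assms(4) by (metis card_seteq)
  then show ?thesis
    using C(4) B(2) assms(2,3) fs.span_minimal[of B A] by (auto simp: fsubspace_def)
qed

lemma fdim_zero [simp]: "fdim {0} = 0"
  by (metis card.empty empty_subsetI fdim_def fs.basis_card_eq_dim fs.independent_empty
      fs.span_empty order.refl)

lemma fin_dim_zero [simp]: "fin_dim {0}"
  by (auto simp: fin_dim_def intro!: exI[of _ "{}"])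

lemma fsubspace_zero [simp]: "fsubspace {0}"
  by (simp add: fsubspace_def)

lemma fsubspace_UNIV [simp]: "fsubspace UNIV"
  by (simp add: fsubspace_def)

text \<open>The coordinates of \<open>x\<close> relative to the joint independent set agree with
  those relative to \<open>B\<close> and with those relative to \<open>C\<close>, so their support
  lies in both sets and is empty.\<close>

lemma span_Int_disjoint:
  fixes B C :: "('i \<Rightarrow> 'k::field) set"
  assumes "fs.independent (B \<union> C)" "B \<inter> C = {}" "x \<in> fs.span B" "x \<in> fs.span C"
  shows "x = 0"
proof -
  have 1: "fs.representation (B \<union> C) x = fs.representation B x"
    and 2: "fs.representation (B \<union> C) x = fs.representation C x"
    using assms by (auto intro: fs.representation_extend)
  have "fs.representation B x b = 0" for b
    using 1 2 assms(2) fs.representation_ne_zero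
    by (metis disjoint_iff)
  moreover have "fs.independent B"
    using assms(1) fs.independent_mono by blast
  ultimately show ?thesis
    using fs.sum_nonzero_representation_eq[OF _ assms(3)] by simp
qed

lemma lin_on_zero:
  assumes "lin_on A T f" "fsubspace A"
  shows "f 0 = 0"
proof -
  have "0 \<in> A"
    using assms(2) by (rule fsubspaceD)
  then have "f (0 + 0) = f 0 + f 0"
    using assms(1) unfolding lin_on_def by blast
  then show ?thesis by simp
qed

text \<open>\<open>lin_on\<close> constrains \<open>f\<close> on \<open>A\<close> only; replacing it
  by a total linear map that agrees on \<open>A\<close> makes the library theory of linear maps
  applicable.\<close>

lemma lin_on_extend:
  assumes "lin_on A T f" "fsubspace A"
  obtains g where "Vector_Spaces.linear fscale fscale g" "\<And>x. x \<in> A \<Longrightarrow> g x = f x"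
proof -
  obtain B where B: "B \<subseteq> A" "fs.independent B" "A \<subseteq> fs.span B"
    using fs.maximal_independent_subset[of A] by auto
  obtain g where g0: "Vector_Spaces.linear fscale fscale g \<and> (\<forall>x\<in>B. g x = f x)"
    using fsp.linear_independent_extend[OF B(2), of f] ..
  then have g: "Vector_Spaces.linear fscale fscale g" "\<And>x. x \<in> B \<Longrightarrow> g x = f x"
    by auto
  have f0: "f 0 = 0"
    using lin_on_zero[OF assms] .
  have "fsubspace {x\<in>A. g x = f x}"
  proof (rule fsubspaceI, goal_cases)
    case 1
    show ?case
      using fsubspaceD(1)[OF assms(2)] f0 fsp.linear_0[OF g(1)] by simp
  next
    case (2 x y)
    then show ?case
      using fsubspaceD(2)[OF assms(2)] assms(1) fsp.linear_add[OF g(1)] by (simp add: lin_on_def)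
  next
    case (3 c x)
    then show ?case
      using fsubspaceD(3)[OF assms(2)] assms(1) fsp.linear_scale[OF g(1)] by (simp add: lin_on_def)
  qed
  then have "fs.span B \<subseteq> {x\<in>A. g x = f x}"
    using B(1) g(2) by (intro fs.span_minimal) (auto simp: fsubspace_def)
  with B(3) show ?thesis
    using g(1) that by blast
qed

lemma lin_on_image_fsubspace:
  assumes "lin_on A T f" "fsubspace A"
  shows "fsubspace (f ` A)"
proof -
  obtain g where g: "Vector_Spaces.linear fscale fscale g" "\<And>x. x \<in> A \<Longrightarrow> g x = f x"
    using lin_on_extend[OF assms] by blast
  have "f ` A = g ` A"
    using g(2) by auto
  then show ?thesis
    using fsp.linear_subspace_image[OF g(1)] assms(2) by (simp add: fsubspace_def)
qed

lemma lin_on_vimage_fsubspace: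
  assumes "lin_on A T f" "fsubspace A" "fsubspace W"
  shows "fsubspace {x\<in>A. f x \<in> W}"
proof -
  obtain g where g: "Vector_Spaces.linear fscale fscale g" "\<And>x. x \<in> A \<Longrightarrow> g x = f x"
    using lin_on_extend[OF assms(1,2)] by blast
  have "{x\<in>A. f x \<in> W} = A \<inter> g -` W"
    using g(2) by auto
  then show ?thesis
    using fsp.linear_subspace_vimage[OF g(1)] assms(2,3)
    by (simp add: fsubspace_def fs.subspace_inter)
qed

lemma lin_on_kernel_fsubspace:
  assumes "lin_on A T f" "fsubspace A"
  shows "fsubspace {x\<in>A. f x = 0}"
  using lin_on_vimage_fsubspace[OF assms fsubspace_zero] by simp

lemma lin_on_subset: "lin_on A T f \<Longrightarrow> B \<subseteq> A \<Longrightarrow> f ` B \<subseteq> W \<Longrightarrow> lin_on B W f"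
  unfolding lin_on_def by blast

lemma rank_nullity:
  assumes lin: "lin_on A T f" and A: "fsubspace A"
    and ker: "fin_dim {x\<in>A. f x = 0}" and im: "fin_dim (f ` A)"
  shows "fin_dim A" and "fdim A = fdim {x\<in>A. f x = 0} + fdim (f ` A)"
proof -
  let ?N = "{x\<in>A. f x = 0}"
  obtain g where g: "Vector_Spaces.linear fscale fscale g" "\<And>x. x \<in> A \<Longrightarrow> g x = f x"
    using lin_on_extend[OF lin A] by blast
  obtain B where B: "finite B" "B \<subseteq> ?N" "fs.independent B" "?N \<subseteq> fs.span B" "card B = fdim ?N"
    using fin_dim_basis[OF ker order.refl] by blast
  obtain E where E: "B \<subseteq> E" "E \<subseteq> A" "fs.independent E" "A \<subseteq> fs.span E"
    using fs.maximal_independent_subset_extend[of B A] B by blast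
  define C where "C = E - B"
  have EC: "E = B \<union> C" "B \<inter> C = {}"
    using E(1) by (auto simp: C_def)
  have CA: "fs.span C \<subseteq> A"
    using A E(2) EC(1) fs.span_minimal[of C A] by (simp add: fsubspace_def)
  have inj: "inj_on g (fs.span C)"
  proof (subst fsp.linear_inj_on_iff_eq_0[OF g(1)], simp, intro ballI impI)
    fix x assume "x \<in> fs.span C" "g x = 0"
    then have "x \<in> ?N"
      using CA g(2) by auto
    then have "x \<in> fs.span B"
      using B(4) by auto
    then show "x = 0"
      using span_Int_disjoint \<open>x \<in> fs.span C\<close> E(3) EC by blast
  qed
  have indC: "fs.independent C"
    using E(3) EC(1) fs.independent_mono by blast
  have indgC: "fs.independent (g ` C)"
    using fsp.linear_independent_injective_image[OF g(1) indC inj] .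
  have gC: "g ` C \<subseteq> f ` A"
    using g(2) E(2) EC(1) by force
  have spans: "f ` A \<subseteq> fs.span (g ` C)"
  proof
    fix y assume "y \<in> f ` A"
    then obtain x where x: "x \<in> A" "y = g x"
      using g(2) by auto
    then obtain b c where bc: "b \<in> fs.span B" "c \<in> fs.span C" "x = b + c"
      using E(4) EC(1) fs.span_Un by blast
    have "b \<in> ?N"
      using bc(1) B(2) lin_on_kernel_fsubspace[OF lin A] fs.span_minimal[of B ?N]
      by (auto simp: fsubspace_def)
    then have "g b = 0"
      using g(2) by auto
    then have "y = g c"
      using x(2) bc(3) fsp.linear_add[OF g(1)] by simp
    then show "y \<in> fs.span (g ` C)"
      using bc(2) fsp.linear_span_image[OF g(1)] by blast
  qed
  obtain D where "finite D" "fs.span D = f ` A"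
    using im by (auto simp: fin_dim_def)
  then have fingC: "finite (g ` C)"
    using fs.independent_span_bound[OF _ indgC] gC by blast
  have injC: "inj_on g C"
    using inj fs.span_superset inj_on_subset by blast
  have finC: "finite C"
    using fingC injC finite_imageD by blast
  show "fin_dim A"
    using fin_dimI[of E] E A finC B(1) EC by auto
  have "fdim (f ` A) = card C"
    using fs.basis_card_eq_dim[OF gC spans indgC] card_image[OF injC] by (simp add: fdim_def)
  moreover have "fdim A = card E"
    using fs.basis_card_eq_dim[OF E(2,4,3)] by (simp add: fdim_def)
  ultimately show "fdim A = fdim ?N + fdim (f ` A)"
    using B(5) EC finC B(1) by (simp add: card_Un_disjoint)
qed

lemma fin_dim_image:
  assumes "lin_on A T f" "fsubspace A" "fin_dim A"
  shows "fin_dim (f ` A)"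
proof -
  obtain g where g: "Vector_Spaces.linear fscale fscale g" "\<And>x. x \<in> A \<Longrightarrow> g x = f x"
    using lin_on_extend[OF assms(1,2)] by blast
  obtain B where B: "finite B" "B \<subseteq> A" "fs.span B = A"
    using assms(3) by (auto simp: fin_dim_def)
  have "f ` A = fs.span (g ` B)"
    using g(2) B(3) fsp.linear_span_image[OF g(1), of B] by auto
  then show ?thesis
    unfolding fin_dim_def using B(1) fs.span_superset[of "g ` B"] by (intro exI[of _ "g ` B"]) simp
qed

lemma fdim_rank_nullity:
  assumes "lin_on A T f" "fsubspace A" "fin_dim A"
  shows "fdim A = fdim {x\<in>A. f x = 0} + fdim (f ` A)"
  using assms by (intro rank_nullity(2) fin_dim_image fin_dim_subset[OF assms(3)]
      lin_on_kernel_fsubspace) auto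

lemma fdim_inj_image:
  assumes "lin_on A T f" "fsubspace A" "fin_dim (f ` A)" "\<And>x. x \<in> A \<Longrightarrow> f x = 0 \<Longrightarrow> x = 0"
  shows "fin_dim A" "fdim (f ` A) = fdim A"
proof -
  have f0: "f 0 = 0"
    using lin_on_zero[OF assms(1,2)] .
  have "{x\<in>A. f x = 0} = {0}"
    using assms(2,4) f0 fsubspaceD(1) by auto
  then show "fin_dim A" "fdim (f ` A) = fdim A"
    using rank_nullity[OF assms(1,2)] assms(3) by auto
qed

section \<open>Direct sums over a finite index set, and the dimension formula for sums and
  intersections\<close>

definition dsums :: "'v set \<Rightarrow> ('v \<Rightarrow> ('i \<Rightarrow> 'k::field) set) \<Rightarrow> ('v \<times> 'i \<Rightarrow> 'k) set" where
  "dsums V W = {u. \<forall>v. (\<lambda>i. u (v,i)) \<in> (if v \<in> V then W v else {0})}"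

lemma fsubspace_dsums:
  assumes "\<And>v. v \<in> V \<Longrightarrow> fsubspace (W v)"
  shows "fsubspace (dsums V W)"
proof (rule fsubspaceI)
  show "0 \<in> dsums V W"
    using assms fsubspaceD(1) by (auto simp: dsums_def zero_fun_def)
next
  fix x y assume xy: "x \<in> dsums V W" "y \<in> dsums V W"
  have "(\<lambda>i. (x + y) (v, i)) \<in> (if v \<in> V then W v else {0})" for v
  proof -
    have eq: "(\<lambda>i. (x + y) (v, i)) = (\<lambda>i. x (v,i)) + (\<lambda>i. y (v,i))"
      by (simp add: plus_fun_def)
    have "fsubspace (if v \<in> V then W v else {0})"
      using assms by simp
    then show ?thesis
      unfolding eq using xy unfolding dsums_def by (intro fsubspaceD(2)) blast+
  qed
  then show "x + y \<in> dsums V W"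
    by (simp add: dsums_def)
next
  fix c x assume x: "x \<in> dsums V W"
  have "(\<lambda>i. (fscale c x) (v, i)) \<in> (if v \<in> V then W v else {0})" for v
  proof -
    have eq: "(\<lambda>i. (fscale c x) (v, i)) = fscale c (\<lambda>i. x (v,i))"
      by (simp add: fscale_def)
    have "fsubspace (if v \<in> V then W v else {0})"
      using assms by simp
    then show ?thesis
      unfolding eq using x unfolding dsums_def by (intro fsubspaceD(3)) blast+
  qed
  then show "fscale c x \<in> dsums V W"
    by (simp add: dsums_def)
qed

text \<open>Induction on the index set: the coordinate at the new index has kernel
  \<open>dsums V W\<close> and image \<open>W a\<close>, so rank-nullity adds the
  dimensions.\<close>

lemma dim_dsums:
  assumes "finite V" "\<And>v. v \<in> V \<Longrightarrow> fsubspace (W v)" "\<And>v. v \<in> V \<Longrightarrow> fin_dim (W v)"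
  shows "fin_dim (dsums V W) \<and> fdim (dsums V W) = (\<Sum>v\<in>V. fdim (W v))"
  using assms
proof (induction V rule: finite_induct)
  case empty
  have "dsums {} W = {0}"
    by (auto simp: dsums_def fun_eq_iff)
  then show ?case by simp
next
  case (insert a V)
  define p :: "('a \<times> 'b \<Rightarrow> 'c) \<Rightarrow> 'b \<Rightarrow> 'c" where "p = (\<lambda>u i. u (a,i))"
  let ?A = "dsums (insert a V) W"
  have lin: "lin_on ?A UNIV p"
    by (auto simp: lin_on_def p_def fscale_def fun_eq_iff)
  have sub: "fsubspace ?A"
    using insert.prems by (intro fsubspace_dsums) auto
  have ker: "{u\<in>?A. p u = 0} = dsums V W"
  proof (rule Set.set_eqI)
    fix u
    have "u \<in> dsums V W \<longleftrightarrow> (\<forall>v. v \<noteq> a \<longrightarrow> (\<lambda>i. u (v,i)) \<in> (if v \<in> V then W v else {0})) \<and> p u = 0"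
      using insert.hyps(2) by (auto simp: dsums_def p_def)
    moreover have "u \<in> ?A \<longleftrightarrow> (\<forall>v. v \<noteq> a \<longrightarrow> (\<lambda>i. u (v,i)) \<in> (if v \<in> V then W v else {0})) \<and> p u \<in> W a"
      unfolding dsums_def p_def by (auto split: if_splits)
    moreover have "0 \<in> W a"
      using insert.prems fsubspaceD(1) by blast
    ultimately show "u \<in> {u\<in>?A. p u = 0} \<longleftrightarrow> u \<in> dsums V W"
      by auto
  qed
  have im: "p ` ?A = W a"
  proof
    show "p ` ?A \<subseteq> W a"
      unfolding dsums_def p_def by (auto dest: spec[of _ a])
    show "W a \<subseteq> p ` ?A"
    proof
      fix w assume "w \<in> W a"
      moreover have "(\<lambda>i. 0) \<in> W v" if "v \<in> V" for v
        using insert.prems(1)[of v] that fsubspaceD(1)[of "W v"] by (simp add: zero_fun_def)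
      ultimately have "(\<lambda>i. case (v,i) of (v,i) \<Rightarrow> if v = a then w i else 0)
          \<in> (if v \<in> insert a V then W v else {0})" for v
        by (cases "v = a") (auto simp: zero_fun_def)
      then have "(\<lambda>(v,i). if v = a then w i else 0) \<in> ?A"
        by (simp add: dsums_def)
      moreover have "p (\<lambda>(v,i). if v = a then w i else 0) = w"
        by (simp add: p_def)
      ultimately show "w \<in> p ` ?A"
        by (metis imageI)
    qed
  qed
  show ?case
    using rank_nullity[OF lin sub] insert by (simp add: ker im)
qed

text \<open>Rank-nullity for addition on the direct sum of \<open>A\<close> and \<open>B\<close>,
  indexed by \<open>bool\<close>. The kernel consists of the pairs \<open>(x, -x)\<close>, and the
  first coordinate identifies it with \<open>A \<inter> B\<close>.\<close>

lemma fdim_sums_Int: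
  assumes A: "fsubspace A" "fin_dim A" and B: "fsubspace B" "fin_dim B"
  shows "fin_dim {x + y | x y. x \<in> A \<and> y \<in> B}"
    "fdim A + fdim B = fdim {x + y | x y. x \<in> A \<and> y \<in> B} + fdim (A \<inter> B)"
proof -
  let ?W = "\<lambda>b. if b then A else B"
  define D where "D = dsums UNIV ?W"
  define f :: "(bool \<times> 'a \<Rightarrow> 'b) \<Rightarrow> 'a \<Rightarrow> 'b" where "f = (\<lambda>u i. u (True,i) + u (False,i))"
  define g :: "(bool \<times> 'a \<Rightarrow> 'b) \<Rightarrow> 'a \<Rightarrow> 'b" where "g = (\<lambda>u i. u (True,i))"
  have dimD: "fin_dim D" "fdim D = fdim A + fdim B"
    using dim_dsums[of UNIV ?W] assms by (auto simp: UNIV_bool D_def)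
  have sub: "fsubspace D"
    unfolding D_def using assms by (intro fsubspace_dsums) auto
  have lin: "lin_on D UNIV f"
    by (auto simp: lin_on_def f_def fscale_def fun_eq_iff algebra_simps)
  have mem: "u \<in> D \<longleftrightarrow> (\<lambda>i. u (True,i)) \<in> A \<and> (\<lambda>i. u (False,i)) \<in> B" for u
    by (auto simp: D_def dsums_def all_bool_eq)
  have im: "f ` D = {x + y | x y. x \<in> A \<and> y \<in> B}"
  proof
    show "f ` D \<subseteq> {x + y | x y. x \<in> A \<and> y \<in> B}"
    proof
      fix z assume "z \<in> f ` D"
      then obtain u where u: "u \<in> D" "z = f u"
        by auto
      then have "z = (\<lambda>i. u (True,i)) + (\<lambda>i. u (False,i))"
        by (simp add: f_def plus_fun_def)
      then show "z \<in> {x + y | x y. x \<in> A \<and> y \<in> B}"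
        using u(1) mem by blast
    qed
    show "{x + y | x y. x \<in> A \<and> y \<in> B} \<subseteq> f ` D"
    proof
      fix z assume "z \<in> {x + y | x y. x \<in> A \<and> y \<in> B}"
      then obtain x y where z: "x \<in> A" "y \<in> B" "z = x + y"
        by auto
      then have "(\<lambda>(b,i). if b then x i else y i) \<in> D"
        by (simp add: mem)
      moreover have "z = f (\<lambda>(b,i). if b then x i else y i)"
        by (simp add: f_def z plus_fun_def)
      ultimately show "z \<in> f ` D"
        by blast
    qed
  qed
  define N where "N = {u\<in>D. f u = 0}"
  have subN: "fsubspace N"
    unfolding N_def using lin_on_kernel_fsubspace[OF lin sub] .
  have linN: "lin_on N UNIV g"
    by (auto simp: lin_on_def g_def fscale_def fun_eq_iff)
  have neg: "- x \<in> A" if "x \<in> A" for x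
    using that A(1) by (simp add: fsubspace_def fs.subspace_neg)
  have negB: "- x \<in> B" if "x \<in> B" for x
    using that B(1) by (simp add: fsubspace_def fs.subspace_neg)
  have gN: "g ` N = A \<inter> B"
  proof
    show "g ` N \<subseteq> A \<inter> B"
    proof
      fix x assume "x \<in> g ` N"
      then obtain u where u: "u \<in> D" "f u = 0" "x = g u"
        by (auto simp: N_def)
      have "x = - (\<lambda>i. u (False,i))"
        using u(2,3) by (auto simp: f_def g_def fun_eq_iff eq_neg_iff_add_eq_0)
      then show "x \<in> A \<inter> B"
        using u(1,3) negB by (auto simp: mem g_def)
    qed
    show "A \<inter> B \<subseteq> g ` N"
    proof
      fix x assume "x \<in> A \<inter> B"
      then have "(\<lambda>(b,i). if b then x i else - x i) \<in> N"
        using negB[of x] by (auto simp: N_def mem f_def fun_eq_iff fun_Compl_def)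
      moreover have "x = g (\<lambda>(b,i). if b then x i else - x i)"
        by (simp add: g_def)
      ultimately show "x \<in> g ` N"
        by blast
    qed
  qed
  have inj: "u = 0" if "u \<in> N" "g u = 0" for u
  proof -
    have "\<forall>i. u (True,i) + u (False,i) = 0" "\<forall>i. u (True,i) = 0"
      using that by (simp_all add: N_def f_def g_def fun_eq_iff)
    then have "u (b,i) = 0" for b i
      by (cases b) auto
    then show ?thesis
      by (auto simp: fun_eq_iff)
  qed
  have "fin_dim (g ` N)"
    unfolding gN using A B by (intro fin_dim_subset[OF A(2)] fsubspace_Int) auto
  then have dimN: "fdim (A \<inter> B) = fdim N"
    using fdim_inj_image(2)[OF linN subN] inj unfolding gN by blast
  have "fdim A + fdim B = fdim N + fdim (f ` D)"
    unfolding N_def dimD(2)[symmetric] by (rule fdim_rank_nullity[OF lin sub dimD(1)])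
  then show "fdim A + fdim B = fdim {x + y | x y. x \<in> A \<and> y \<in> B} + fdim (A \<inter> B)"
    unfolding im dimN by (simp only: add.commute)
  show "fin_dim {x + y | x y. x \<in> A \<and> y \<in> B}"
    using fin_dim_image[OF lin sub dimD(1)] unfolding im .
qed

lemma fsubspace_sums:
  "fsubspace A \<Longrightarrow> fsubspace B \<Longrightarrow> fsubspace {x + y | x y. x \<in> A \<and> y \<in> B}"
  by (simp add: fsubspace_def fs.subspace_sums)

lemma fin_dim_UNIV_unit: "fin_dim (UNIV :: (unit \<Rightarrow> 'k::field) set)"
  and fdim_UNIV_unit: "fdim (UNIV :: (unit \<Rightarrow> 'k::field) set) = 1"
proof -
  let ?b = "(\<lambda>_. 1) :: unit \<Rightarrow> 'k"
  have "x \<in> fs.span {?b}" for x :: "unit \<Rightarrow> 'k"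
  proof -
    have "x = fscale (x ()) ?b"
      by (auto simp: fscale_def)
    then show ?thesis
      by (metis fs.span_base fs.span_scale singletonI)
  qed
  then have span: "UNIV = fs.span {?b}"
    by auto
  then show "fin_dim (UNIV :: (unit \<Rightarrow> 'k::field) set)"
    by (auto simp: fin_dim_def intro!: exI[of _ "{?b}"])
  have "fs.independent {?b}"
    by (simp add: fun_eq_iff)
  then show "fdim (UNIV :: (unit \<Rightarrow> 'k::field) set) = 1"
    unfolding fdim_def span using fs.dim_span_eq_card_independent by fastforce
qed

text \<open>Pivot positions of an echelon form: the places where the dimension of \<open>U\<close>
  jumps along the standard flag. They grow with \<open>U\<close> and count its dimension, so several
  subspaces can be compared through finite sets without choosing compatible bases.\<close>

definition top_indices :: "(nat \<Rightarrow> 'k::field) set \<Rightarrow> nat set" where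
  "top_indices U = {j. \<exists>u\<in>U. u j \<noteq> 0 \<and> (\<forall>i>j. u i = 0)}"

text \<open>Induction on \<open>n\<close>: reading the entry at \<open>n\<close> is either zero on
  \<open>U\<close>, or has rank one and contributes exactly the pivot \<open>n\<close>; the kernel
  supplies the remaining pivots.\<close>

lemma fdim_eq_card_top_indices:
  assumes "fsubspace U" "U \<subseteq> {f. \<forall>i\<ge>n. f i = 0}"
  shows "fin_dim U \<and> fdim U = card (top_indices U) \<and> top_indices U \<subseteq> {..<n}"
  using assms
proof (induction n arbitrary: U)
  case 0
  then have "U = {0}"
    using fsubspaceD(1) by (auto simp: fun_eq_iff)
  then show ?case
    by (simp add: top_indices_def)
next
  case (Suc n)
  \<comment> \<open>Scalars are wrapped as functions on \<open>unit\<close>, because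
    \<open>fdim\<close> speaks of subspaces of function spaces.\<close>
  define p :: "(nat \<Rightarrow> 'a) \<Rightarrow> unit \<Rightarrow> 'a" where "p = (\<lambda>u _. u n)"
  have lin: "lin_on U UNIV p"
    by (auto simp: lin_on_def p_def fscale_def fun_eq_iff)
  let ?N = "{u\<in>U. p u = 0}"
  have subN: "fsubspace ?N"
    using lin_on_kernel_fsubspace[OF lin Suc.prems(1)] .
  have N: "?N \<subseteq> {f. \<forall>i\<ge>n. f i = 0}"
  proof
    fix f assume f: "f \<in> ?N"
    have "f i = 0" if "i \<ge> n" for i
      using f that Suc.prems(2) by (cases "i = n") (auto simp: p_def fun_eq_iff)
    then show "f \<in> {f. \<forall>i\<ge>n. f i = 0}"
      by simp
  qed
  note IH = Suc.IH[OF subN N]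
  have imsub: "fsubspace (p ` U)"
    using lin_on_image_fsubspace[OF lin Suc.prems(1)] .
  have imfin: "fin_dim (p ` U)"
    using fin_dim_subset[OF fin_dim_UNIV_unit _ imsub] by simp
  note rn = rank_nullity[OF lin Suc.prems(1) _ imfin]
  have bound: "top_indices U \<subseteq> {..<Suc n}"
  proof
    fix j assume "j \<in> top_indices U"
    then obtain u where "u \<in> U" "u j \<noteq> 0"
      by (auto simp: top_indices_def)
    then show "j \<in> {..<Suc n}"
      using Suc.prems(2) by (metis (mono_tags, lifting) lessThan_iff linorder_not_less mem_Collect_eq subsetD)
  qed
  show ?case
  proof (cases "p ` U = {0}")
    case True
    then have "?N = U"
      by auto
    then show ?thesis
      using IH bound by simp
  next
    case False
    have "\<exists>u\<in>U. u n \<noteq> 0"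
    proof (rule ccontr)
      assume "\<not> (\<exists>u\<in>U. u n \<noteq> 0)"
      then have "p ` U \<subseteq> {0}"
        by (auto simp: p_def fun_eq_iff)
      then show False
        using False fsubspaceD(1)[OF imsub] by blast
    qed
    then obtain u where u: "u \<in> U" "u n \<noteq> 0"
      by blast
    have "p ` U = UNIV"
    proof -
      have "w \<in> p ` U" for w
      proof -
        have "w = fscale (w () / u n) (p u)"
          using u by (auto simp: fscale_def p_def)
        then show ?thesis
          using fsubspaceD(3)[OF imsub] u(1) by (metis imageI)
      qed
      then show ?thesis by auto
    qed
    then have "fdim (p ` U) = 1"
      by (simp add: fdim_UNIV_unit)
    moreover have "top_indices U = insert n (top_indices ?N)"
    proof
      show "top_indices U \<subseteq> insert n (top_indices ?N)"
      proof
        fix j assume j: "j \<in> top_indices U"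
        then obtain v where v: "v \<in> U" "v j \<noteq> 0" "\<forall>i>j. v i = 0"
          by (auto simp: top_indices_def)
        have "j < Suc n"
          using j bound by auto
        then show "j \<in> insert n (top_indices ?N)"
          using v by (cases "j = n") (auto simp: top_indices_def p_def fun_eq_iff)
      qed
      show "insert n (top_indices ?N) \<subseteq> top_indices U"
      proof -
        have "\<forall>i>n. u i = 0"
          using u(1) Suc.prems(2) by auto
        then have "n \<in> top_indices U"
          using u unfolding top_indices_def by blast
        then show ?thesis
          by (auto simp: top_indices_def)
      qed
    qed
    moreover have "n \<notin> top_indices ?N" "finite (top_indices ?N)"
      using IH finite_subset by auto
    ultimately show ?thesis
      using rn IH bound by simp
  qed
qed

section \<open>Excess of families of subspaces\<close>

text \<open>The summand at \<open>e\<close> of \<open>Gamma_ht\<close> for a direct sum of vertex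
  subspaces, with \<open>S\<close> at the tail and \<open>T\<close> at the head.\<close>

definition edge_space :: "('v,'e,'i,'k::field) sheaf \<Rightarrow> 'e \<Rightarrow> ('i \<Rightarrow> 'k) set \<Rightarrow> ('i \<Rightarrow> 'k) set \<Rightarrow> ('i \<Rightarrow> 'k) set" where
  "edge_space F e S T = {w\<in>se F e. rt F e w \<in> S \<and> rh F e w \<in> T}"

text \<open>The quantity maximized in \<open>max_excess\<close>, evaluated at the direct sum of the
  \<open>U v\<close>; the identification is made in \<open>excess_le_max_excess\<close>.\<close>

definition excess :: "('v,'e) bigraph \<Rightarrow> ('v,'e,'i,'k::field) sheaf \<Rightarrow> ('v \<Rightarrow> ('i \<Rightarrow> 'k) set) \<Rightarrow> int" where
  "excess B F U = (\<Sum>e\<in>barcs B. int (fdim (edge_space F e (U (btail B e)) (U (bhead B e)))))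
     - (\<Sum>v\<in>bverts B. int (fdim (U v)))"

definition family :: "('v,'e) bigraph \<Rightarrow> ('v,'e,'i,'k::field) sheaf \<Rightarrow> ('v \<Rightarrow> ('i \<Rightarrow> 'k) set) \<Rightarrow> bool" where
  "family B F U = (\<forall>v\<in>bverts B. fsubspace (U v) \<and> U v \<subseteq> sv F v)"

lemma familyD:
  assumes "family B F U" "v \<in> bverts B"
  shows "fsubspace (U v)" "U v \<subseteq> sv F v"
  using assms by (auto simp: family_def)

lemma family_fin_dim:
  assumes "is_sheaf B F" "family B F U" "v \<in> bverts B"
  shows "fin_dim (U v)"
  using assms fin_dim_subset[of "sv F v" "U v"] by (auto simp: family_def is_sheaf_def)

lemma wf_bigraphD:
  assumes "wf_bigraph B"
  shows "finite (bverts B)" "finite (barcs B)"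
    "\<And>e. e \<in> barcs B \<Longrightarrow> btail B e \<in> bverts B" "\<And>e. e \<in> barcs B \<Longrightarrow> bhead B e \<in> bverts B"
    "\<And>e. e \<in> barcs B \<Longrightarrow> bcol B e \<in> {1,2}"
  using assms by (auto simp: wf_bigraph_def)

lemma fsubspace_edge_space:
  assumes "is_sheaf B F" "e \<in> barcs B" "fsubspace S" "fsubspace T"
  shows "fsubspace (edge_space F e S T)"
proof -
  have l: "lin_on (se F e) (sv F (btail B e)) (rt F e)" "lin_on (se F e) (sv F (bhead B e)) (rh F e)"
    "fsubspace (se F e)"
    using assms by (auto simp: is_sheaf_def)
  have "edge_space F e S T = {w\<in>se F e. rt F e w \<in> S} \<inter> {w\<in>se F e. rh F e w \<in> T}"
    by (auto simp: edge_space_def)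
  then show ?thesis
    using fsubspace_Int[OF lin_on_vimage_fsubspace[OF l(1,3) assms(3)]
        lin_on_vimage_fsubspace[OF l(2,3) assms(4)]] by simp
qed

lemma fin_dim_edge_space:
  assumes "is_sheaf B F" "e \<in> barcs B" "fsubspace S" "fsubspace T"
  shows "fin_dim (edge_space F e S T)"
  using assms fsubspace_edge_space[OF assms] fin_dim_subset[of "se F e"]
  by (auto simp: is_sheaf_def edge_space_def)

definition fplus :: "('i \<Rightarrow> 'k::field) set \<Rightarrow> ('i \<Rightarrow> 'k) set \<Rightarrow> ('i \<Rightarrow> 'k) set" where
  "fplus S T = {x + y | x y. x \<in> S \<and> y \<in> T}"

lemma fsubspace_fplus: "fsubspace S \<Longrightarrow> fsubspace T \<Longrightarrow> fsubspace (fplus S T)"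
  by (simp add: fplus_def fsubspace_sums)

lemma family_Int:
  "family B F U \<Longrightarrow> family B F W \<Longrightarrow> family B F (\<lambda>v. U v \<inter> W v)"
  by (auto simp: family_def fsubspace_Int)

lemma family_fplus:
  assumes "is_sheaf B F" "family B F U" "family B F W"
  shows "family B F (\<lambda>v. fplus (U v) (W v))"
  unfolding family_def
proof (intro ballI conjI)
  fix v assume v: "v \<in> bverts B"
  note U = familyD[OF assms(2) v] and W = familyD[OF assms(3) v]
  show "fsubspace (fplus (U v) (W v))"
    using U(1) W(1) by (rule fsubspace_fplus)
  have "fsubspace (sv F v)"
    using assms(1) v by (simp add: is_sheaf_def)
  then show "fplus (U v) (W v) \<subseteq> sv F v"
    using U(2) W(2) fsubspaceD(2)[of "sv F v"] by (auto simp: fplus_def)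
qed

text \<open>Vertex dimensions are modular. At an arc, the edge spaces of \<open>U\<close> and
  \<open>W\<close> meet exactly in the edge space of the intersection, while their sum is only
  contained in that of the sum; this inclusion gives the inequality.\<close>

lemma excess_supermodular:
  assumes wf: "wf_bigraph B" and F: "is_sheaf B F" and U: "family B F U" and W: "family B F W"
  shows "excess B F U + excess B F W \<le> excess B F (\<lambda>v. U v \<inter> W v) + excess B F (\<lambda>v. fplus (U v) (W v))"
proof -
  let ?g = "\<lambda>U e. int (fdim (edge_space F e (U (btail B e)) (U (bhead B e))))"
  let ?I = "\<lambda>v. U v \<inter> W v" and ?S = "\<lambda>v. fplus (U v) (W v)"
  have edge: "?g U e + ?g W e \<le> ?g ?I e + ?g ?S e" if e: "e \<in> barcs B" for e
  proof -
    note te = wf_bigraphD(3)[OF wf e] and he = wf_bigraphD(4)[OF wf e]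
    let ?A = "edge_space F e (U (btail B e)) (U (bhead B e))"
    let ?B = "edge_space F e (W (btail B e)) (W (bhead B e))"
    let ?C = "edge_space F e (?S (btail B e)) (?S (bhead B e))"
    have sub: "fsubspace ?A" "fsubspace ?B" and fin: "fin_dim ?A" "fin_dim ?B" and C: "fin_dim ?C"
      using F U W te he e
      by (auto intro!: fsubspace_edge_space fin_dim_edge_space fsubspace_fplus simp: familyD(1))
    have Int: "edge_space F e (?I (btail B e)) (?I (bhead B e)) = ?A \<inter> ?B"
      by (auto simp: edge_space_def)
    have "fplus ?A ?B \<subseteq> ?C"
    proof
      fix z assume "z \<in> fplus ?A ?B"
      then obtain x y where z: "z = x + y" and x: "x \<in> ?A" and y: "y \<in> ?B"
        by (auto simp: fplus_def)
      have "fsubspace (se F e)" "lin_on (se F e) (sv F (btail B e)) (rt F e)"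
        "lin_on (se F e) (sv F (bhead B e)) (rh F e)"
        using F e by (auto simp: is_sheaf_def)
      then have "x + y \<in> se F e" "rt F e (x + y) = rt F e x + rt F e y"
        "rh F e (x + y) = rh F e x + rh F e y"
        using x y by (auto simp: edge_space_def lin_on_def fsubspaceD(2))
      then show "z \<in> ?C"
        using x y unfolding z edge_space_def fplus_def by auto
    qed
    then have "fdim (fplus ?A ?B) \<le> fdim ?C"
      using fdim_mono C by blast
    then show ?thesis
      using fdim_sums_Int(2)[OF sub(1) fin(1) sub(2) fin(2)] unfolding Int fplus_def by linarith
  qed
  have vert: "int (fdim (U v)) + int (fdim (W v)) = int (fdim (?I v)) + int (fdim (?S v))"
    if v: "v \<in> bverts B" for v
    using fdim_sums_Int(2)[of "U v" "W v"] familyD[OF U v] familyD[OF W v] family_fin_dim[OF F U v]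
      family_fin_dim[OF F W v] unfolding fplus_def by linarith
  have "(\<Sum>e\<in>barcs B. ?g U e) + (\<Sum>e\<in>barcs B. ?g W e)
      \<le> (\<Sum>e\<in>barcs B. ?g ?I e) + (\<Sum>e\<in>barcs B. ?g ?S e)"
    unfolding sum.distrib[symmetric] using edge by (intro sum_mono) auto
  moreover have "(\<Sum>v\<in>bverts B. int (fdim (U v))) + (\<Sum>v\<in>bverts B. int (fdim (W v)))
      = (\<Sum>v\<in>bverts B. int (fdim (?I v))) + (\<Sum>v\<in>bverts B. int (fdim (?S v)))"
    unfolding sum.distrib[symmetric] using vert by (intro sum.cong) auto
  ultimately show ?thesis
    unfolding excess_def by linarith
qed

lemma excess_bounded:
  assumes "is_sheaf B F" "family B F U"
  shows "excess B F U \<le> (\<Sum>e\<in>barcs B. int (fdim (se F e)))"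
proof -
  have "(\<Sum>e\<in>barcs B. int (fdim (edge_space F e (U (btail B e)) (U (bhead B e)))))
      \<le> (\<Sum>e\<in>barcs B. int (fdim (se F e)))"
    using assms by (intro sum_mono) (auto intro!: fdim_mono simp: is_sheaf_def edge_space_def)
  moreover have "0 \<le> (\<Sum>v\<in>bverts B. int (fdim (U v)))"
    by (simp add: sum_nonneg)
  ultimately show ?thesis
    unfolding excess_def by linarith
qed

text \<open>By supermodularity the maximal families are closed under intersection.\<close>

lemma exists_least_maximal_family:
  assumes wf: "wf_bigraph B" and F: "is_sheaf B F"
  obtains U where "family B F U" "\<And>W. family B F W \<Longrightarrow> excess B F W \<le> excess B F U"
    "\<And>W v. family B F W \<Longrightarrow> excess B F W = excess B F U \<Longrightarrow> v \<in> bverts B \<Longrightarrow> U v \<subseteq> W v"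
proof -
  let ?M = "\<Sum>e\<in>barcs B. int (fdim (se F e))"
  have "family B F (\<lambda>v. {0})"
    using F fsubspaceD(1) by (auto simp: family_def is_sheaf_def)
  \<comment> \<open>Minimizing the truncated deficit maximizes the excess;
    \<open>excess_bounded\<close> makes every deficit nonnegative, so the truncation by
    \<open>nat\<close> changes nothing.\<close>
  then obtain U0 where U0: "family B F U0"
    "\<And>W. family B F W \<Longrightarrow> nat (?M - excess B F U0) \<le> nat (?M - excess B F W)"
    using ex_has_least_nat[of "family B F" _ "\<lambda>U. nat (?M - excess B F U)"] by blast
  have max: "excess B F W \<le> excess B F U0" if "family B F W" for W
    using U0(2)[OF that] excess_bounded[OF F U0(1)] excess_bounded[OF F that] by linarith
  let ?d = "\<lambda>U. \<Sum>v\<in>bverts B. fdim (U v)"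
  \<comment> \<open>Among the maximizers, one of least total dimension. Intersecting it with another
    maximizer gives a maximizer again, so no vertex dimension can drop, and equality of dimensions
    becomes inclusion.\<close>
  obtain U where U: "family B F U" "excess B F U = excess B F U0"
    "\<And>W. family B F W \<Longrightarrow> excess B F W = excess B F U0 \<Longrightarrow> ?d U \<le> ?d W"
    using ex_has_least_nat[of "\<lambda>U. family B F U \<and> excess B F U = excess B F U0" U0 ?d] U0(1) by blast
  show ?thesis
  proof (rule that[OF U(1)])
    show "excess B F W \<le> excess B F U" if "family B F W" for W
      using max[OF that] U(2) by simp
  next
    fix W v assume W: "family B F W" "excess B F W = excess B F U" and v: "v \<in> bverts B"
    let ?I = "\<lambda>v. U v \<inter> W v"
    have I: "family B F ?I"
      using U(1) W(1) by (rule family_Int)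
    have "excess B F U0 \<le> excess B F ?I"
      using excess_supermodular[OF wf F U(1) W(1)] max[OF family_fplus[OF F U(1) W(1)]] W(2) U(2)
      by linarith
    then have dle: "?d U \<le> ?d ?I"
      using max[OF I] U(3)[OF I] by linarith
    have le: "fdim (?I x) \<le> fdim (U x)" if "x \<in> bverts B" for x
      using family_fin_dim[OF F U(1) that] by (intro fdim_mono) auto
    have "fdim (?I v) = fdim (U v)"
    proof (rule ccontr)
      assume "fdim (?I v) \<noteq> fdim (U v)"
      then have "fdim (?I v) < fdim (U v)"
        using le[OF v] by simp
      then have "?d ?I < ?d U"
        using wf_bigraphD(1)[OF wf] v le by (intro sum_strict_mono_ex1) auto
      then show False
        using dle by simp
    qed
    then have "?I v = U v"
      using fdim_eq_imp_eq[OF family_fin_dim[OF F U(1) v], of "?I v"] familyD(1)[OF I v] by auto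
    then show "U v \<subseteq> W v"
      by blast
  qed
qed

section \<open>Pullback along the first projection of a product, and Galois coverings\<close>

definition pull :: "('v,'e,'i,'k::field) sheaf \<Rightarrow> ('v \<times> 'x, 'e \<times> 'y, 'i, 'k) sheaf" where
  "pull F = \<lparr> sv = (\<lambda>(v,x). sv F v), se = (\<lambda>(e,y). se F e),
     rt = (\<lambda>(e,y). rt F e), rh = (\<lambda>(e,y). rh F e) \<rparr>"

lemma pull_simps [simp]:
  "sv (pull F) (v,x) = sv F v" "se (pull F) (e,y) = se F e"
  "rt (pull F) (e,y) = rt F e" "rh (pull F) (e,y) = rh F e"
  "edge_space (pull F) (e,y) S T = edge_space F e S T"
  by (simp_all add: pull_def edge_space_def)

lemma fprod_simps [simp]:
  "bverts (fprod B C) = bverts B \<times> bverts C"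
  "(e,y) \<in> barcs (fprod B C) \<longleftrightarrow> e \<in> barcs B \<and> y \<in> barcs C \<and> bcol B e = bcol C y"
  "btail (fprod B C) (e,y) = (btail B e, btail C y)"
  "bhead (fprod B C) (e,y) = (bhead B e, bhead C y)"
  "bcol (fprod B C) (e,y) = bcol B e"
  by (simp_all add: fprod_def)

lemma cayley_simps [simp]:
  "bverts (cayley G g1 g2) = carrier G" "barcs (cayley G g1 g2) = carrier G \<times> {1,2}"
  "btail (cayley G g1 g2) (g,i) = g"
  "bhead (cayley G g1 g2) (g,i) = (if i = 1 then g1 else g2) \<otimes>\<^bsub>G\<^esub> g"
  "bcol (cayley G g1 g2) (g,i) = i"
  by (simp_all add: cayley_def)

lemma wf_fprod:
  assumes "wf_bigraph B" "wf_bigraph C"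
  shows "wf_bigraph (fprod B C)"
proof -
  have "finite (barcs (fprod B C))"
    using wf_bigraphD(2)[OF assms(1)] wf_bigraphD(2)[OF assms(2)]
    by (intro finite_subset[of "barcs (fprod B C)" "barcs B \<times> barcs C"]) auto
  then show ?thesis
    using assms unfolding wf_bigraph_def by auto
qed

lemma wf_cayley:
  assumes "group G" "finite (carrier G)" "g1 \<in> carrier G" "g2 \<in> carrier G"
  shows "wf_bigraph (cayley G g1 g2)"
  using assms by (auto simp: wf_bigraph_def group.is_monoid intro: monoid.m_closed)

lemma is_sheaf_pull:
  assumes "is_sheaf B F"
  shows "is_sheaf (fprod B C) (pull F)"
  using assms by (auto simp: is_sheaf_def)

text \<open>A Cayley bigraph has exactly one arc of each colour leaving each \<open>x\<close>, so
  the product covers \<open>B\<close>: over an arc \<open>e\<close> there is one arc for each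
  \<open>x\<close>.\<close>

lemma sum_fprod_cayley:
  assumes "wf_bigraph B"
  shows "(\<Sum>p\<in>barcs (fprod B (cayley S s1 s2)). f p)
    = (\<Sum>(e,x)\<in>barcs B \<times> carrier S. f (e,(x,bcol B e)))"
  using assms
  by (intro sum.reindex_bij_witness[of _ "\<lambda>(e,x). (e,(x,bcol B e))" "\<lambda>(e,(x,i)). (e,x)"])
    (auto simp: wf_bigraph_def)

text \<open>Right translation by \<open>t\<close> preserves the excess, so the least maximizer
  \<open>M\<close> lies inside its own translate. Transitivity on fibres then makes \<open>M\<close>
  constant along them, and a fibrewise constant family has \<open>card (carrier S)\<close> times the
  excess of the family it induces on \<open>B\<close>.\<close>

lemma excess_Galois:
  assumes wf: "wf_bigraph B" and F: "is_sheaf B F"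
    and S: "group S" "finite (carrier S)" "s1 \<in> carrier S" "s2 \<in> carrier S"
    and le: "\<And>W. family B F W \<Longrightarrow> excess B F W \<le> c"
    and U: "family (fprod B (cayley S s1 s2)) (pull F) U"
  shows "excess (fprod B (cayley S s1 s2)) (pull F) U \<le> int (card (carrier S)) * c"
proof -
  interpret S: group S by fact
  define P where "P = fprod B (cayley S s1 s2)"
  define g where "g i = (if i = (1::nat) then s1 else s2)" for i
  have g: "g i \<in> carrier S" for i
    using S(3,4) by (simp add: g_def)
  define PF :: "('a \<times> 'e, 'b \<times> 'e \<times> nat, 'c, 'd) sheaf" where "PF = pull F"
  have wfP: "wf_bigraph P"
    unfolding P_def by (intro wf_fprod wf wf_cayley S)
  have sP: "is_sheaf P PF"
    unfolding P_def PF_def by (rule is_sheaf_pull[OF F])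
  have vP: "bverts P = bverts B \<times> carrier S"
    by (simp add: P_def)
  have excP: "excess P PF W = (\<Sum>(e,x)\<in>barcs B \<times> carrier S.
        int (fdim (edge_space F e (W (btail B e, x)) (W (bhead B e, g (bcol B e) \<otimes>\<^bsub>S\<^esub> x)))))
      - (\<Sum>v\<in>bverts B \<times> carrier S. int (fdim (W v)))" for W
    unfolding excess_def P_def sum_fprod_cayley[OF wf] PF_def
    by (simp add: g_def case_prod_unfold)
  obtain M where M: "family P PF M" "\<And>W. family P PF W \<Longrightarrow> excess P PF W \<le> excess P PF M"
    "\<And>W v. family P PF W \<Longrightarrow> excess P PF W = excess P PF M \<Longrightarrow> v \<in> bverts P \<Longrightarrow> M v \<subseteq> W v"
    using exists_least_maximal_family[OF wfP sP] by blast
  have shift: "M (v,x) \<subseteq> M (v, x \<otimes>\<^bsub>S\<^esub> t)"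
    if t: "t \<in> carrier S" and v: "v \<in> bverts B" and x: "x \<in> carrier S" for v x t
  proof -
    let ?W = "\<lambda>(v,x). M (v, x \<otimes>\<^bsub>S\<^esub> t)"
    have fW: "family P PF ?W"
      using M(1) t unfolding family_def vP by (auto simp: PF_def)
    have "(\<Sum>(e,x)\<in>barcs B \<times> carrier S.
        int (fdim (edge_space F e (?W (btail B e, x)) (?W (bhead B e, g (bcol B e) \<otimes>\<^bsub>S\<^esub> x)))))
      = (\<Sum>(e,x)\<in>barcs B \<times> carrier S.
        int (fdim (edge_space F e (M (btail B e, x)) (M (bhead B e, g (bcol B e) \<otimes>\<^bsub>S\<^esub> x)))))"
      using t g
      by (intro sum.reindex_bij_witness[of _ "\<lambda>(e,x). (e,x \<otimes>\<^bsub>S\<^esub> inv\<^bsub>S\<^esub> t)" "\<lambda>(e,x). (e, x \<otimes>\<^bsub>S\<^esub> t)"])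
        (auto simp: S.m_assoc)
    moreover have "(\<Sum>v\<in>bverts B \<times> carrier S. int (fdim (?W v)))
      = (\<Sum>v\<in>bverts B \<times> carrier S. int (fdim (M v)))"
      using t
      by (intro sum.reindex_bij_witness[of _ "\<lambda>(e,x). (e,x \<otimes>\<^bsub>S\<^esub> inv\<^bsub>S\<^esub> t)" "\<lambda>(e,x). (e, x \<otimes>\<^bsub>S\<^esub> t)"])
        (auto simp: S.m_assoc)
    ultimately have "excess P PF ?W = excess P PF M"
      unfolding excP by simp
    from M(3)[OF fW this, of "(v,x)"] v x show ?thesis
      by (simp add: vP)
  qed
  define W where "W v = M (v, \<one>\<^bsub>S\<^esub>)" for v
  \<comment> \<open>The two inclusions come from translating the unit by \<open>x\<close> and
    translating \<open>x\<close> by its inverse.\<close>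
  have MW: "M (v,x) = W v" if "v \<in> bverts B" "x \<in> carrier S" for v x
    using shift[OF that(2,1) S.one_closed] shift[OF _ that, of "inv\<^bsub>S\<^esub> x"] that(2)
    by (auto simp: W_def)
  have fW: "family B F W"
    using M(1) unfolding family_def vP W_def by (auto simp: PF_def)
  have "excess P PF M = (\<Sum>(e,x)\<in>barcs B \<times> carrier S. int (fdim (edge_space F e (W (btail B e)) (W (bhead B e)))))
      - (\<Sum>(v,x)\<in>bverts B \<times> carrier S. int (fdim (W v)))"
    unfolding excP using wf_bigraphD[OF wf] g
    by (intro arg_cong2[of _ _ _ _ "(-)"] sum.cong) (auto simp: MW)
  also have "\<dots> = int (card (carrier S)) * excess B F W"
    by (simp add: excess_def sum.cartesian_product[symmetric] sum_distrib_left right_diff_distrib)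
  also have "\<dots> \<le> int (card (carrier S)) * c"
    using le[OF fW] by (simp add: mult_left_mono)
  finally show ?thesis
    using order_trans[OF M(2)[of U]] U unfolding P_def PF_def by blast
qed

section \<open>Comparison of families with the maximum excess\<close>

lemma embV_in_dsums_iff:
  assumes "v \<in> V" "\<And>v. v \<in> V \<Longrightarrow> fsubspace (W v)"
  shows "embV v x \<in> dsums V W \<longleftrightarrow> x \<in> W v"
proof -
  have eq: "(\<lambda>i. embV v x (v',i)) = (if v' = v then x else 0)" for v'
    by (auto simp: embV_def)
  have "0 \<in> W v'" if "v' \<in> V" for v'
    using fsubspaceD(1)[OF assms(2)[OF that]] .
  then show ?thesis
    using assms(1) unfolding dsums_def mem_Collect_eq eq by auto
qed

text \<open>The conditions in \<open>Gamma_ht\<close> are imposed arc by arc, so for a direct sum of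
  vertex subspaces it splits into the direct sum of the edge spaces.\<close>

lemma excess_le_max_excess:
  assumes wf: "wf_bigraph B" and F: "is_sheaf B F" and W: "family B F W"
  shows "excess B F W \<le> max_excess B F"
proof -
  let ?U = "dsums (bverts B) W"
  let ?D = "{int (fdim (Gamma_ht B F U)) - int (fdim U) | U. fsubspace U \<and> U \<subseteq> totV B F}"
  have totV: "totV B F = dsums (bverts B) (sv F)" and totE: "totE B F = dsums (barcs B) (se F)"
    by (simp_all add: totV_def totE_def dsums_def)
  have finV: "fin_dim (totV B F)" and finE: "fin_dim (totE B F)"
    unfolding totV totE using F dim_dsums wf_bigraphD(1,2)[OF wf] by (auto simp: is_sheaf_def)
  \<comment> \<open>\<open>Max\<close> is meaningful only on a finite set. There may be infinitely
    many \<open>U\<close>, but the values are integers in a bounded interval.\<close>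
  have "?D \<subseteq> {- int (fdim (totV B F)) .. int (fdim (totE B F))}"
  proof
    fix d assume "d \<in> ?D"
    then obtain U where U: "d = int (fdim (Gamma_ht B F U)) - int (fdim U)" "U \<subseteq> totV B F"
      by auto
    have "fdim (Gamma_ht B F U) \<le> fdim (totE B F)"
      by (intro fdim_mono[OF finE]) (auto simp: Gamma_ht_def)
    moreover have "fdim U \<le> fdim (totV B F)"
      by (intro fdim_mono[OF finV] U(2))
    ultimately show "d \<in> {- int (fdim (totV B F)) .. int (fdim (totE B F))}"
      using U(1) by simp
  qed
  then have finD: "finite ?D"
    by (rule finite_subset) simp
  have subW: "fsubspace (W v)" "fin_dim (W v)" if "v \<in> bverts B" for v
    using familyD(1)[OF W that] family_fin_dim[OF F W that] by auto
  have subU: "fsubspace ?U"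
    using subW(1) by (rule fsubspace_dsums)
  have UV: "?U \<subseteq> totV B F"
  proof
    fix u assume u: "u \<in> ?U"
    have "(\<lambda>i. u (v,i)) \<in> (if v \<in> bverts B then sv F v else {0})" for v
    proof -
      have "(\<lambda>i. u (v,i)) \<in> (if v \<in> bverts B then W v else {0})"
        using u by (simp add: dsums_def)
      then show ?thesis
        using familyD(2)[OF W, of v] by (cases "v \<in> bverts B") auto
    qed
    then show "u \<in> totV B F"
      by (simp add: totV_def)
  qed
  let ?G = "\<lambda>e. edge_space F e (W (btail B e)) (W (bhead B e))"
  have "Gamma_ht B F ?U = dsums (barcs B) ?G"
  proof (rule Set.set_eqI)
    fix w
    have "w \<in> Gamma_ht B F ?U \<longleftrightarrow> w \<in> totE B F \<and> (\<forall>e\<in>barcs B.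
        rh F e (\<lambda>i. w (e,i)) \<in> W (bhead B e) \<and> rt F e (\<lambda>i. w (e,i)) \<in> W (btail B e))"
      using wf_bigraphD(3,4)[OF wf] subW(1) by (auto simp: Gamma_ht_def embV_in_dsums_iff)
    also have "\<dots> \<longleftrightarrow> w \<in> dsums (barcs B) ?G"
      unfolding totE_def dsums_def edge_space_def by (auto split: if_splits)
    finally show "w \<in> Gamma_ht B F ?U \<longleftrightarrow> w \<in> dsums (barcs B) ?G" .
  qed
  moreover have "fdim (dsums (barcs B) ?G) = (\<Sum>e\<in>barcs B. fdim (?G e))"
    using wf_bigraphD[OF wf] subW(1) F
    by (intro conjunct2[OF dim_dsums]) (auto intro!: fsubspace_edge_space fin_dim_edge_space)
  moreover have "fdim ?U = (\<Sum>v\<in>bverts B. fdim (W v))"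
    using wf_bigraphD(1)[OF wf] subW by (intro conjunct2[OF dim_dsums]) auto
  ultimately have "excess B F W = int (fdim (Gamma_ht B F ?U)) - int (fdim ?U)"
    by (simp add: excess_def)
  then have "excess B F W \<in> ?D"
    using subU UV by blast
  then show ?thesis
    unfolding max_excess_def using finD by (rule Max_ge[rotated])
qed

section \<open>Pullback along an etale bigraph\<close>

lemma inj_on_extends_to_Bij:
  assumes "finite V" "A \<subseteq> V" "inj_on f A" "f ` A \<subseteq> V"
  obtains h where "h \<in> Bij V" "\<And>a. a \<in> A \<Longrightarrow> h a = f a"
proof -
  \<comment> \<open>In a finite set the complements of \<open>A\<close> and of its injective image
    have equal size, so any bijection between them completes \<open>f\<close>.\<close>
  have "card (V - A) = card (V - f ` A)"
    using assms by (simp add: card_Diff_subset finite_subset card_image)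
  then obtain k where k: "bij_betw k (V - A) (V - f ` A)"
    using assms(1) by (metis finite_Diff finite_same_card_bij)
  \<comment> \<open>\<open>Bij V\<close> contains only extensional functions, which forces the value
    \<open>undefined\<close> outside \<open>V\<close>.\<close>
  let ?h = "\<lambda>x. if x \<in> V then if x \<in> A then f x else k x else undefined"
  have "bij_betw ?h (A \<union> (V - A)) (f ` A \<union> (V - f ` A))"
  proof (rule bij_betw_combine)
    show "bij_betw ?h A (f ` A)"
      using assms(2,3) by (auto simp: bij_betw_def inj_on_def)
    show "bij_betw ?h (V - A) (V - f ` A)"
      using k by (subst bij_betw_cong[of _ _ k]) auto
  qed auto
  moreover have "A \<union> (V - A) = V" "f ` A \<union> (V - f ` A) = V"
    using assms(2,4) by auto
  ultimately have "?h \<in> Bij V"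
    by (simp add: Bij_def extensional_def)
  then show ?thesis
    using assms(2) by (intro that[of ?h]) auto
qed

text \<open>In an etale bigraph the arcs of one colour form the graph of a partial injection from
  tails to heads, and a partial injection of a finite set extends to a permutation.\<close>

lemma etale_colour_permutation:
  assumes "wf_bigraph C" "etale C"
  obtains h where "h \<in> Bij (bverts C)" "\<And>y. y \<in> barcs C \<Longrightarrow> bcol C y = i \<Longrightarrow> h (btail C y) = bhead C y"
proof -
  let ?E = "{y\<in>barcs C. bcol C y = i}"
  let ?f = "\<lambda>v. bhead C (inv_into ?E (btail C) v)"
  have inj: "inj_on (btail C) ?E" and injh: "inj_on (bhead C) ?E"
    using assms(2) unfolding etale_def inj_on_def by blast+
  have f: "?f (btail C y) = bhead C y" if "y \<in> ?E" for y
    using inv_into_f_f[OF inj that] by simp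
  obtain h where h: "h \<in> Bij (bverts C)" "\<And>a. a \<in> btail C ` ?E \<Longrightarrow> h a = ?f a"
  proof (rule inj_on_extends_to_Bij[of "bverts C" "btail C ` ?E" ?f])
    show "finite (bverts C)" "btail C ` ?E \<subseteq> bverts C"
      using wf_bigraphD[OF assms(1)] by auto
    show "inj_on ?f (btail C ` ?E)"
    proof (rule inj_onI)
      fix u v assume "u \<in> btail C ` ?E" "v \<in> btail C ` ?E" "?f u = ?f v"
      then obtain x y where "x \<in> ?E" "y \<in> ?E" "u = btail C x" "v = btail C y"
        "bhead C x = bhead C y"
        using f by auto
      then show "u = v"
        using inj_onD[OF injh] by blast
    qed
    show "?f ` btail C ` ?E \<subseteq> bverts C"
      using f wf_bigraphD(4)[OF assms(1)] by auto
  qed blast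
  show ?thesis
    using f h by (intro that[OF h(1)]) auto
qed

text \<open>Completing the colour classes of \<open>C\<close> to permutations embeds the product into a covering of \<open>B\<close>;
the orbit maps \<open>s \<mapsto> s v\<close> pull a family on it back to the Galois covering by the permutation group,
and summing over all \<open>v\<close> recovers its excess.\<close>

lemma excess_etale_pullback:
  assumes wf: "wf_bigraph B" and F: "is_sheaf B F" and C: "wf_bigraph C" "etale C"
    and le: "\<And>W. family B F W \<Longrightarrow> excess B F W \<le> 0"
    and U: "family (fprod B C) (pull F) U"
  shows "excess (fprod B C) (pull F) U \<le> 0"
proof -
  let ?V = "bverts C"
  define S where "S = BijGroup ?V"
  obtain h1 where h1: "h1 \<in> Bij ?V" "\<And>y. y \<in> barcs C \<Longrightarrow> bcol C y = 1 \<Longrightarrow> h1 (btail C y) = bhead C y"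
    using etale_colour_permutation[OF C] by blast
  obtain h2 where h2: "h2 \<in> Bij ?V" "\<And>y. y \<in> barcs C \<Longrightarrow> bcol C y = 2 \<Longrightarrow> h2 (btail C y) = bhead C y"
    using etale_colour_permutation[OF C] by blast
  define h where "h i = (if i = (1::nat) then h1 else h2)" for i
  have h: "h i \<in> Bij ?V" for i
    using h1(1) h2(1) by (simp add: h_def)
  have hy: "h (bcol C y) (btail C y) = bhead C y" if "y \<in> barcs C" for y
    using that h1(2) h2(2) wf_bigraphD(5)[OF C(1) that] by (auto simp: h_def)
  have S: "group S" "carrier S = Bij ?V"
    by (auto simp: S_def group_BijGroup) (auto simp: BijGroup_def)
  have mult: "(g \<otimes>\<^bsub>S\<^esub> s) v = g (s v)" if "g \<in> Bij ?V" "s \<in> Bij ?V" "v \<in> ?V" for g s v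
    using that by (simp add: S_def BijGroup_def compose_def)
  have finS: "finite (carrier S)"
  proof -
    have "Bij ?V \<subseteq> ?V \<rightarrow>\<^sub>E ?V"
      by (auto simp: Bij_def PiE_def extensional_def dest: bij_betwE)
    then show ?thesis
      unfolding S(2) using wf_bigraphD(1)[OF C(1)] by (metis finite_PiE finite_subset)
  qed
  \<comment> \<open>The arc terms of the completed covering: the head over \<open>v\<close> is
    \<open>h (bcol B e) v\<close>, whether or not \<open>C\<close> has an arc of that colour leaving
    \<open>v\<close>.\<close>
  define Q where "Q e v = int (fdim (edge_space F e (U (btail B e, v)) (U (bhead B e, h (bcol B e) v))))" for e v
  define R where "R v p = int (fdim (U (p,v)))" for v p
  have orbit: "(\<Sum>(e,s)\<in>barcs B \<times> Bij ?V. Q e (s v)) - (\<Sum>(p,s)\<in>bverts B \<times> Bij ?V. R (s v) p) \<le> 0"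
    if v: "v \<in> ?V" for v
  proof -
    \<comment> \<open>The orbit map is equivariant, \<open>(h s) v = h (s v)\<close>, so the arc
      over \<open>e\<close> at \<open>s\<close> contributes \<open>Q e (s v)\<close>.\<close>
    let ?W = "\<lambda>(p,s). U (p, s v)"
    have sv: "s v \<in> ?V" if "s \<in> Bij ?V" for s
      using v that by (auto simp: Bij_def dest: bij_betwE)
    have "family (fprod B (cayley S h1 h2)) (pull F) ?W"
      using U sv by (auto simp: family_def S)
    then have "excess (fprod B (cayley S h1 h2)) (pull F) ?W \<le> int (card (carrier S)) * 0"
      using excess_Galois[OF wf F S(1) finS _ _ le, of h1 h2] h1(1) h2(1) S(2) by blast
    moreover have "excess (fprod B (cayley S h1 h2)) (pull F) ?W
      = (\<Sum>(e,s)\<in>barcs B \<times> Bij ?V. Q e (s v)) - (\<Sum>(p,s)\<in>bverts B \<times> Bij ?V. R (s v) p)"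
    proof -
      have "(\<Sum>p\<in>barcs (fprod B (cayley S h1 h2)). int (fdim (edge_space (pull F) p
          (?W (btail (fprod B (cayley S h1 h2)) p)) (?W (bhead (fprod B (cayley S h1 h2)) p)))))
        = (\<Sum>(e,s)\<in>barcs B \<times> Bij ?V. Q e (s v))"
        unfolding sum_fprod_cayley[OF wf] S(2) Q_def using h mult[OF _ _ v]
        by (intro sum.cong) (auto simp: h_def)
      then show ?thesis
        unfolding excess_def by (simp add: S(2) R_def case_prod_unfold)
    qed
    ultimately show ?thesis
      by simp
  qed
  \<comment> \<open>Each single orbit map may hit vertices unevenly, or miss some. Summing over all
    \<open>v\<close> repairs this: for fixed \<open>s\<close> the point \<open>s v\<close> runs once
    through the vertices.\<close>
  have reindex: "(\<Sum>v\<in>?V. f (s v) :: int) = (\<Sum>v\<in>?V. f v)" if "s \<in> Bij ?V" for s f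
    using that sum.reindex_bij_betw[of s ?V ?V f] by (simp add: Bij_def)
  have "(\<Sum>v\<in>?V. (\<Sum>(e,s)\<in>barcs B \<times> Bij ?V. Q e (s v)))
      = (\<Sum>(e,s)\<in>barcs B \<times> Bij ?V. (\<Sum>v\<in>?V. Q e v))"
    unfolding case_prod_unfold by (subst sum.swap) (intro sum.cong refl reindex, auto)
  also have "\<dots> = int (card (Bij ?V)) * (\<Sum>e\<in>barcs B. \<Sum>v\<in>?V. Q e v)"
    by (simp add: sum.cartesian_product[symmetric] sum_distrib_left)
  finally have 1: "(\<Sum>v\<in>?V. (\<Sum>(e,s)\<in>barcs B \<times> Bij ?V. Q e (s v)))
      = int (card (Bij ?V)) * (\<Sum>e\<in>barcs B. \<Sum>v\<in>?V. Q e v)" .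
  have "(\<Sum>v\<in>?V. (\<Sum>(p,s)\<in>bverts B \<times> Bij ?V. R (s v) p))
      = (\<Sum>(p,s)\<in>bverts B \<times> Bij ?V. (\<Sum>v\<in>?V. R v p))"
    unfolding case_prod_unfold by (subst sum.swap) (intro sum.cong refl reindex[of _ "\<lambda>v. R v _"], auto)
  also have "\<dots> = int (card (Bij ?V)) * (\<Sum>p\<in>bverts B. \<Sum>v\<in>?V. R v p)"
    by (simp add: sum.cartesian_product[symmetric] sum_distrib_left)
  finally have 2: "(\<Sum>v\<in>?V. (\<Sum>(p,s)\<in>bverts B \<times> Bij ?V. R (s v) p))
      = int (card (Bij ?V)) * (\<Sum>p\<in>bverts B. \<Sum>v\<in>?V. R v p)" .
  have "(\<Sum>v\<in>?V. (\<Sum>(e,s)\<in>barcs B \<times> Bij ?V. Q e (s v))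
      - (\<Sum>(p,s)\<in>bverts B \<times> Bij ?V. R (s v) p)) \<le> 0"
    using orbit by (rule sum_nonpos)
  then have "int (card (Bij ?V)) * ((\<Sum>e\<in>barcs B. \<Sum>v\<in>?V. Q e v) - (\<Sum>p\<in>bverts B. \<Sum>v\<in>?V. R v p)) \<le> 0"
    unfolding sum_subtractf 1 2 by (simp add: right_diff_distrib)
  moreover have "card (Bij ?V) > 0"
    using finS h unfolding S(2) card_gt_0_iff by blast
  ultimately have 3: "(\<Sum>e\<in>barcs B. \<Sum>v\<in>?V. Q e v) \<le> (\<Sum>p\<in>bverts B. \<Sum>v\<in>?V. R v p)"
    by (simp add: mult_le_0_iff)
  let ?P = "fprod B C"
  let ?t = "\<lambda>(e,y). (e, btail C y)"
  \<comment> \<open>The component \<open>e\<close> fixes the colour, and at most one arc of that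
    colour leaves a given vertex of \<open>C\<close>.\<close>
  have inj: "inj_on ?t (barcs ?P)"
    using C(2) unfolding etale_def by (auto simp: inj_on_def) (metis)
  have "(\<Sum>p\<in>barcs ?P. int (fdim (edge_space (pull F) p (U (btail ?P p)) (U (bhead ?P p)))))
      = (\<Sum>p\<in>barcs ?P. case ?t p of (e,v) \<Rightarrow> Q e v)"
    by (intro sum.cong) (auto simp: Q_def hy)
  also have "\<dots> = (\<Sum>(e,v)\<in>?t ` barcs ?P. Q e v)"
    by (simp only: sum.reindex[OF inj] comp_def)
  \<comment> \<open>The additional pairs are the arcs created by the completion; their terms are
    dimensions, hence nonnegative.\<close>
  also have "\<dots> \<le> (\<Sum>(e,v)\<in>barcs B \<times> ?V. Q e v)"
    using wf_bigraphD[OF wf] wf_bigraphD[OF C(1)] by (intro sum_mono2) (auto simp: Q_def)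
  also have "\<dots> = (\<Sum>e\<in>barcs B. \<Sum>v\<in>?V. Q e v)"
    by (simp add: sum.cartesian_product)
  also note 3
  also have "(\<Sum>p\<in>bverts B. \<Sum>v\<in>?V. R v p) = (\<Sum>p\<in>bverts ?P. int (fdim (U p)))"
    by (simp add: sum.cartesian_product R_def case_prod_unfold)
  finally show ?thesis
    unfolding excess_def by simp
qed

section \<open>Subadditivity of the excess along short exact sequences\<close>

definition pull_map :: "('v,'e,'i,'j,'k) sheaf_map \<Rightarrow> ('v \<times> 'x, 'e \<times> 'y, 'i, 'j, 'k) sheaf_map" where
  "pull_map a = \<lparr> mv = (\<lambda>(v,x). mv a v), mE = (\<lambda>(e,y). mE a e) \<rparr>"

lemma pull_map_simps [simp]:
  "mv (pull_map a) (v,x) = mv a v" "mE (pull_map a) (e,y) = mE a e"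
  by (simp_all add: pull_map_def)

lemma short_exact_pull:
  assumes "short_exact B K A Q a b"
  shows "short_exact (fprod B C) (pull K) (pull A) (pull Q) (pull_map a) (pull_map b)"
  using assms unfolding short_exact_def
  by (auto simp: is_sheaf_pull is_morphism_def)

text \<open>\<open>U1\<close> is the preimage of \<open>U\<close> in \<open>K\<close> and
  \<open>U3\<close> its image in \<open>Q\<close>. Vertex dimensions then add up exactly. At an arc,
  the image of the edge space of \<open>A\<close> need not fill the edge space of \<open>Q\<close>
  for \<open>U3\<close>, which leaves an inequality in the desired direction.\<close>

lemma excess_short_exact:
  assumes wf: "wf_bigraph B" and ex: "short_exact B K A Q a b" and U: "family B A U"
  obtains U1 U3 where "family B K U1" "family B Q U3" "excess B A U \<le> excess B K U1 + excess B Q U3"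
proof -
  have sh: "is_sheaf B K" "is_sheaf B A" "is_sheaf B Q"
    and ma: "is_morphism B K A a" and mb: "is_morphism B A Q b"
    using ex by (simp_all add: short_exact_def)
  have exv: "exact_at (sv K v) (sv A v) (sv Q v) (mv a v) (mv b v)" if "v \<in> bverts B" for v
    using ex that by (simp add: short_exact_def)
  have exe: "exact_at (se K e) (se A e) (se Q e) (mE a e) (mE b e)" if "e \<in> barcs B" for e
    using ex that by (simp add: short_exact_def)
  define U1 where "U1 v = {z\<in>sv K v. mv a v z \<in> U v}" for v
  define U3 where "U3 v = mv b v ` U v" for v
  have la: "lin_on (sv K v) (sv A v) (mv a v)" and lb: "lin_on (U v) (sv Q v) (mv b v)"
    and sK: "fsubspace (sv K v)" and fU: "fin_dim (U v)" and sU: "fsubspace (U v)"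
    if v: "v \<in> bverts B" for v
  proof -
    show "lin_on (sv K v) (sv A v) (mv a v)" "fsubspace (sv K v)"
      using ma sh(1) v by (auto simp: is_morphism_def is_sheaf_def)
    show "fin_dim (U v)" "fsubspace (U v)"
      using family_fin_dim[OF sh(2) U v] familyD(1)[OF U v] .
    have l: "lin_on (sv A v) (sv Q v) (mv b v)"
      using mb v by (simp add: is_morphism_def)
    then have "mv b v ` U v \<subseteq> sv Q v"
      using familyD(2)[OF U v] unfolding lin_on_def by blast
    then show "lin_on (U v) (sv Q v) (mv b v)"
      by (rule lin_on_subset[OF l familyD(2)[OF U v]])
  qed
  have fam1: "family B K U1"
    unfolding family_def U1_def using lin_on_vimage_fsubspace[OF la sK sU] by blast
  have fam3: "family B Q U3"
    unfolding family_def U3_def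
  proof (intro ballI conjI)
    fix v assume v: "v \<in> bverts B"
    show "fsubspace (mv b v ` U v)"
      using lin_on_image_fsubspace[OF lb[OF v] sU[OF v]] .
    show "mv b v ` U v \<subseteq> sv Q v"
      using lb[OF v] unfolding lin_on_def by blast
  qed
  have vert: "fdim (U v) = fdim (U1 v) + fdim (U3 v)" if v: "v \<in> bverts B" for v
  proof -
    have ker: "{x\<in>U v. mv b v x = 0} = mv a v ` U1 v"
    proof -
      have "mv a v ` sv K v = {x\<in>sv A v. mv b v x = 0}"
        using exv[OF v] by (simp add: exact_at_def)
      moreover have "mv a v ` U1 v = mv a v ` sv K v \<inter> U v"
        by (auto simp: U1_def)
      ultimately show ?thesis
        using familyD(2)[OF U v] by auto
    qed
    have lin: "lin_on (U1 v) (sv A v) (mv a v)"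
      using la[OF v] by (auto simp: U1_def lin_on_def)
    have sub: "fsubspace (U1 v)"
      using familyD(1)[OF fam1 v] .
    have inj: "x = 0" if "x \<in> U1 v" "mv a v x = 0" for x
    proof -
      have "mv a v x = mv a v 0"
        using that(2) lin_on_zero[OF lin sub] by simp
      moreover have "inj_on (mv a v) (sv K v)"
        using exv[OF v] by (simp add: exact_at_def)
      ultimately show ?thesis
        using that(1) fsubspaceD(1)[OF sK[OF v]] by (auto simp: U1_def dest: inj_onD)
    qed
    have "fin_dim (mv a v ` U1 v)"
      using fin_dim_image[OF lin sub family_fin_dim[OF sh(1) fam1 v]] .
    then have "fdim (mv a v ` U1 v) = fdim (U1 v)"
      using fdim_inj_image(2)[OF lin sub] inj by blast
    then show ?thesis
      using fdim_rank_nullity[OF lb[OF v] sU[OF v] fU[OF v]] unfolding ker U3_def by simp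
  qed
  let ?g = "\<lambda>F U e. fdim (edge_space F e (U (btail B e)) (U (bhead B e)))"
  have edge: "?g A U e \<le> ?g K U1 e + ?g Q U3 e" if e: "e \<in> barcs B" for e
  proof -
    note t = wf_bigraphD(3)[OF wf e] and h = wf_bigraphD(4)[OF wf e]
    let ?W = "edge_space A e (U (btail B e)) (U (bhead B e))"
    let ?W1 = "edge_space K e (U1 (btail B e)) (U1 (bhead B e))"
    let ?W3 = "edge_space Q e (U3 (btail B e)) (U3 (bhead B e))"
    have W: "fsubspace ?W" "fin_dim ?W"
      using fsubspace_edge_space[OF sh(2) e sU[OF t] sU[OF h]] fin_dim_edge_space[OF sh(2) e sU[OF t] sU[OF h]] .
    have W1: "fsubspace ?W1" "fin_dim ?W1"
      by (intro fsubspace_edge_space[OF sh(1) e] fin_dim_edge_space[OF sh(1) e] familyD(1)[OF fam1] t h)+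
    have W3: "fin_dim ?W3"
      by (intro fin_dim_edge_space[OF sh(3) e] familyD(1)[OF fam3] t h)
    have lA: "lin_on (se K e) (se A e) (mE a e)" and lQ: "lin_on (se A e) (se Q e) (mE b e)"
      and cA: "\<And>w. w \<in> se K e \<Longrightarrow> rt A e (mE a e w) = mv a (btail B e) (rt K e w)"
        "\<And>w. w \<in> se K e \<Longrightarrow> rh A e (mE a e w) = mv a (bhead B e) (rh K e w)"
      and cQ: "\<And>w. w \<in> se A e \<Longrightarrow> rt Q e (mE b e w) = mv b (btail B e) (rt A e w)"
        "\<And>w. w \<in> se A e \<Longrightarrow> rh Q e (mE b e w) = mv b (bhead B e) (rh A e w)"
      using ma mb e by (auto simp: is_morphism_def)
    have rK: "\<And>w. w \<in> se K e \<Longrightarrow> rt K e w \<in> sv K (btail B e)"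
      "\<And>w. w \<in> se K e \<Longrightarrow> rh K e w \<in> sv K (bhead B e)"
      using sh(1) e by (auto simp: is_sheaf_def lin_on_def)
    have linb: "lin_on ?W (se Q e) (mE b e)"
      using lQ by (auto simp: edge_space_def lin_on_def)
    have lina: "lin_on ?W1 (se A e) (mE a e)"
      using lA by (auto simp: edge_space_def lin_on_def)
    have im: "mE b e ` ?W \<subseteq> ?W3"
      using lQ cQ by (auto simp: edge_space_def U3_def lin_on_def)
    \<comment> \<open>Exactness at the arc lifts \<open>w\<close> to some \<open>z\<close> in
      \<open>K\<close>; compatibility with the restriction maps places the restrictions of
      \<open>z\<close> in \<open>U1\<close>.\<close>
    have ker: "{w\<in>?W. mE b e w = 0} \<subseteq> mE a e ` ?W1"
    proof
      fix w assume w: "w \<in> {w\<in>?W. mE b e w = 0}"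
      then have "w \<in> mE a e ` se K e"
        using exe[OF e] by (auto simp: exact_at_def edge_space_def)
      then obtain z where z: "z \<in> se K e" "w = mE a e z"
        by blast
      then have "z \<in> ?W1"
        using w cA rK by (auto simp: edge_space_def U1_def)
      then show "w \<in> mE a e ` ?W1"
        using z(2) by blast
    qed
    have "fdim (mE a e ` ?W1) \<le> fdim ?W1"
      unfolding fdim_rank_nullity[OF lina W1] by (rule le_add2)
    moreover have "fdim {w\<in>?W. mE b e w = 0} \<le> fdim (mE a e ` ?W1)"
      using fdim_mono[OF fin_dim_image[OF lina W1] ker] .
    moreover have "fdim (mE b e ` ?W) \<le> fdim ?W3"
      using fdim_mono[OF W3 im] .
    ultimately show ?thesis
      unfolding fdim_rank_nullity[OF linb W] by (intro add_mono) (rule order_trans)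
  qed
  have "(\<Sum>e\<in>barcs B. int (?g A U e)) \<le> (\<Sum>e\<in>barcs B. int (?g K U1 e)) + (\<Sum>e\<in>barcs B. int (?g Q U3 e))"
    unfolding sum.distrib[symmetric] using edge by (intro sum_mono) (metis of_nat_add of_nat_mono)
  moreover have "(\<Sum>v\<in>bverts B. int (fdim (U v)))
      = (\<Sum>v\<in>bverts B. int (fdim (U1 v))) + (\<Sum>v\<in>bverts B. int (fdim (U3 v)))"
    unfolding sum.distrib[symmetric] using vert by (intro sum.cong) auto
  ultimately have "excess B A U \<le> excess B K U1 + excess B Q U3"
    unfolding excess_def by linarith
  with fam1 fam3 show ?thesis
    by (rule that)
qed

section \<open>Reduced cyclicity and the constant sheaf\<close>

definition arcs_in :: "('v,'e) bigraph \<Rightarrow> 'v set \<Rightarrow> 'e set" where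
  "arcs_in B T = {e\<in>barcs B. btail B e \<in> T \<and> bhead B e \<in> T}"

definition edge_rel :: "('v,'e) bigraph \<Rightarrow> ('v \<times> 'v) set" where
  "edge_rel B = {(btail B e, bhead B e) | e. e \<in> barcs B} \<union> {(bhead B e, btail B e) | e. e \<in> barcs B}"

lemma conn_rel_edge_rel:
  "conn_rel B = {(u,w). u \<in> bverts B \<and> w \<in> bverts B \<and> (u,w) \<in> (edge_rel B)\<^sup>*}"
  by (simp add: conn_rel_def edge_rel_def)

lemma equiv_conn_rel: "equiv (bverts B) (conn_rel B)"
proof (rule equivI)
  have "sym (edge_rel B)"
    by (auto simp: sym_def edge_rel_def)
  then have "sym ((edge_rel B)\<^sup>*)"
    by (rule sym_rtrancl)
  then show "sym (conn_rel B)"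
    by (auto simp: conn_rel_edge_rel sym_def)
  show "trans (conn_rel B)"
    by (auto simp: conn_rel_edge_rel intro!: transI)
qed (auto simp: conn_rel_edge_rel refl_on_def)

lemma component_closed:
  assumes "wf_bigraph B" "X \<in> components B" "(u,w) \<in> edge_rel B" "u \<in> X"
  shows "w \<in> X"
proof -
  have "u \<in> bverts B" "w \<in> bverts B"
    using assms(1,3) by (auto simp: edge_rel_def wf_bigraph_def)
  then have "(u,w) \<in> conn_rel B"
    using assms(3) by (auto simp: conn_rel_edge_rel)
  then show ?thesis
    using assms(2,4) in_quotient_imp_closed[OF equiv_conn_rel[of B]] unfolding components_def
    by blast
qed

lemma component_edge:
  assumes "wf_bigraph B" "X \<in> components B" "e \<in> barcs B"
  shows "btail B e \<in> X \<longleftrightarrow> bhead B e \<in> X"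
  using component_closed[OF assms(1,2)] assms(3) unfolding edge_rel_def by blast

lemma component_connected:
  assumes "X \<in> components B" "u \<in> X" "w \<in> X"
  shows "(u,w) \<in> (edge_rel B)\<^sup>*"
proof -
  have "(u,w) \<in> conn_rel B"
    using assms equiv_conn_rel[of B] unfolding components_def by (metis quotient_eq_iff)
  then show ?thesis
    by (simp add: conn_rel_edge_rel)
qed

lemma component_subset: "X \<in> components B \<Longrightarrow> X \<subseteq> bverts B"
  using equiv_conn_rel[of B] unfolding components_def by (metis in_quotient_imp_subset)

lemma Union_components: "\<Union> (components B) = bverts B"
  unfolding components_def by (rule Union_quotient[OF equiv_conn_rel])

lemma components_disjoint:
  "X \<in> components B \<Longrightarrow> Y \<in> components B \<Longrightarrow> X \<noteq> Y \<Longrightarrow> X \<inter> Y = {}"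
  using quotient_disj[OF equiv_conn_rel[of B]] unfolding components_def by blast

lemma finite_components: "finite (bverts B) \<Longrightarrow> finite (components B)"
  using Union_components[of B] finite_UnionD by metis

lemma card_sum_components:
  assumes "finite A" "\<And>a. a \<in> A \<Longrightarrow> f a \<in> bverts B" "finite (bverts B)"
  shows "card A = (\<Sum>X\<in>components B. card {a\<in>A. f a \<in> X})"
proof -
  have "A = (\<Union>X\<in>components B. {a\<in>A. f a \<in> X})"
    using assms(2) Union_components[of B] by blast
  also have "card \<dots> = (\<Sum>X\<in>components B. card {a\<in>A. f a \<in> X})"
  proof (intro card_UN_disjoint finite_components ballI impI assms(3))
    fix X Y assume "X \<in> components B" "Y \<in> components B" "X \<noteq> Y"
    then have "X \<inter> Y = {}"
      by (rule components_disjoint)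
    then show "{a\<in>A. f a \<in> X} \<inter> {a\<in>A. f a \<in> Y} = {}"
      by blast
  qed (use assms(1) in simp)
  finally show ?thesis .
qed

lemma connected_crossing:
  assumes "X \<in> components B" "Y \<subseteq> X" "Y \<noteq> {}" "Y \<noteq> X"
  obtains y z where "y \<in> Y" "z \<notin> Y" "(y,z) \<in> edge_rel B"
proof -
  obtain y x where yx: "y \<in> Y" "x \<in> X" "x \<notin> Y"
    using assms by blast
  have "(y,x) \<in> (edge_rel B)\<^sup>*"
    using component_connected[OF assms(1)] yx assms(2) by blast
  then have "\<exists>y\<in>Y. \<exists>z. z \<notin> Y \<and> (y,z) \<in> edge_rel B"
    using yx(1,3)
  proof (induction rule: rtrancl_induct)
    case (step a b)
    then show ?case
      by (cases "a \<in> Y") auto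
  qed auto
  then show ?thesis
    using that by blast
qed

text \<open>\<open>Y\<close> grows to \<open>X\<close> one vertex at a time along an arc that
  crosses its boundary, and each step gains at least one arc. Nonemptiness matters: the empty set
  has difference 0, a tree component has -1.\<close>

lemma excess_component:
  assumes wf: "wf_bigraph B" and X: "X \<in> components B"
  shows "Y \<subseteq> X \<Longrightarrow> Y \<noteq> {} \<Longrightarrow>
    int (card (arcs_in B Y)) - int (card Y) \<le> int (card (arcs_in B X)) - int (card X)"
proof (induction "card (X - Y)" arbitrary: Y rule: less_induct)
  case less
  have finX: "finite X"
    using component_subset[OF X] wf_bigraphD(1)[OF wf] by (rule finite_subset)
  show ?case
  proof (cases "Y = X")
    case False
    obtain y z where yz: "y \<in> Y" "z \<notin> Y" "(y,z) \<in> edge_rel B"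
      using connected_crossing[OF X less.prems(1,2) False] .
    have z: "z \<in> X"
      using component_closed[OF wf X yz(3)] yz(1) less.prems(1) by blast
    let ?Z = "insert z Y"
    obtain e where e: "e \<in> barcs B" "{btail B e, bhead B e} = {y,z}"
      using yz(3) by (auto simp: edge_rel_def)
    then have "e \<in> arcs_in B ?Z" "e \<notin> arcs_in B Y"
      using yz(1,2) unfolding arcs_in_def by (auto simp: doubleton_eq_iff)
    moreover have "arcs_in B Y \<subseteq> arcs_in B ?Z" "finite (arcs_in B ?Z)"
      using wf_bigraphD(2)[OF wf] by (auto simp: arcs_in_def)
    ultimately have "card (arcs_in B Y) < card (arcs_in B ?Z)"
      by (intro psubset_card_mono) auto
    moreover have "card ?Z = Suc (card Y)"
      using yz(2) less.prems(1) finX by (simp add: finite_subset)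
    moreover have "card (X - ?Z) < card (X - Y)"
      using finX z yz(2) by (intro psubset_card_mono) auto
    then have "int (card (arcs_in B ?Z)) - int (card ?Z) \<le> int (card (arcs_in B X)) - int (card X)"
      using less.prems z by (intro less.hyps) auto
    ultimately show ?thesis
      by simp
  qed simp
qed

lemma arcs_in_component:
  assumes "wf_bigraph B" "X \<in> components B"
  shows "{e\<in>barcs B. btail B e \<in> X} = arcs_in B X"
  using component_edge[OF assms] by (auto simp: arcs_in_def)

lemma rho_eq:
  assumes "wf_bigraph B"
  shows "int (rho B) = (\<Sum>X\<in>components B. max 0 (int (card (arcs_in B X)) - int (card X)))"
  using assms by (simp add: rho_def arcs_in_component)

lemma excess_sum_components:
  assumes wf: "wf_bigraph B" and T: "T \<subseteq> bverts B"
  shows "int (card (arcs_in B T)) - int (card T)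
    = (\<Sum>X\<in>components B. int (card (arcs_in B (T \<inter> X))) - int (card (T \<inter> X)))"
proof -
  have "card (arcs_in B T) = (\<Sum>X\<in>components B. card {e\<in>arcs_in B T. btail B e \<in> X})"
    using wf_bigraphD[OF wf] by (intro card_sum_components) (auto simp: arcs_in_def)
  also have "\<dots> = (\<Sum>X\<in>components B. card (arcs_in B (T \<inter> X)))"
    using component_edge[OF wf] by (intro sum.cong refl arg_cong[of _ _ card]) (auto simp: arcs_in_def)
  finally have 1: "card (arcs_in B T) = (\<Sum>X\<in>components B. card (arcs_in B (T \<inter> X)))" .
  have 2: "card T = (\<Sum>X\<in>components B. card (T \<inter> X))"
    unfolding Int_def using T wf_bigraphD(1)[OF wf]
    by (intro card_sum_components[of T "\<lambda>v. v" B]) (auto intro: finite_subset)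
  show ?thesis
    unfolding 1 2 by (simp add: sum_subtractf)
qed

text \<open>Together with \<open>excess_attains_rho\<close> this describes \<open>rho\<close> as a
  maximum over vertex subsets, the form in which it can be compared with excess. In each component a
  nonempty part of \<open>T\<close> is dominated by the whole component, an empty part by 0.\<close>

lemma excess_le_rho:
  assumes wf: "wf_bigraph B" and T: "T \<subseteq> bverts B"
  shows "int (card (arcs_in B T)) - int (card T) \<le> int (rho B)"
  unfolding excess_sum_components[OF assms] rho_eq[OF wf]
proof (rule sum_mono)
  fix X assume X: "X \<in> components B"
  show "int (card (arcs_in B (T \<inter> X))) - int (card (T \<inter> X))
      \<le> max 0 (int (card (arcs_in B X)) - int (card X))"
  proof (cases "T \<inter> X = {}")
    case True
    then show ?thesis
      by (simp add: arcs_in_def)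
  next
    case False
    then show ?thesis
      using excess_component[OF wf X, of "T \<inter> X"] by auto
  qed
qed

lemma excess_attains_rho:
  assumes wf: "wf_bigraph B"
  obtains T where "T \<subseteq> bverts B" "int (card (arcs_in B T)) - int (card T) = int (rho B)"
proof
  \<comment> \<open>The components whose difference is nonnegative; for the others the term in
    \<open>rho\<close> is cut off at 0, matching the empty intersection with
    \<open>?T\<close>.\<close>
  let ?good = "{X\<in>components B. card X \<le> card (arcs_in B X)}"
  let ?T = "\<Union> ?good"
  show T: "?T \<subseteq> bverts B"
    using component_subset by blast
  show "int (card (arcs_in B ?T)) - int (card ?T) = int (rho B)"
    unfolding excess_sum_components[OF wf T] rho_eq[OF wf]
  proof (rule sum.cong[OF refl])
    fix X assume X: "X \<in> components B"
    show "int (card (arcs_in B (?T \<inter> X))) - int (card (?T \<inter> X))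
      = max 0 (int (card (arcs_in B X)) - int (card X))"
    proof (cases "X \<in> ?good")
      case True
      then have "?T \<inter> X = X"
        by blast
      then show ?thesis
        using True by simp
    next
      case False
      then have "?T \<inter> X = {}"
        using components_disjoint[OF _ X] by blast
      then show ?thesis
        using False X by (simp add: arcs_in_def)
    qed
  qed
qed

section \<open>Excess of the constant sheaf\<close>

lemma is_sheaf_const: "is_sheaf B (const_sheaf n :: ('v,'e,nat,'k::field) sheaf)"
proof -
  let ?C = "{f :: nat \<Rightarrow> 'k. \<forall>i\<ge>n. f i = 0}"
  have sub: "fsubspace ?C"
    by (rule fsubspaceI) (auto simp: fscale_def)
  have fin: "fin_dim ?C"
    by (rule conjunct1[OF fdim_eq_card_top_indices[OF sub order.refl]])
  have "lin_on ?C ?C (\<lambda>w. w)"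
    by (simp add: lin_on_def)
  with sub fin show ?thesis
    by (simp add: is_sheaf_def const_sheaf_def)
qed

text \<open>For each \<open>j < n\<close> the vertices where \<open>j\<close> is a pivot form a set
  \<open>?T j\<close>. Vertex dimensions count memberships in these sets and edge dimensions are at
  most the number of sets containing both ends, so the excess is bounded by \<open>n\<close>
  combinatorial differences, each at most \<open>rho B\<close>.\<close>

lemma excess_const_sheaf:
  assumes wf: "wf_bigraph B" and U: "family B (const_sheaf n) U"
  shows "excess B (const_sheaf n) U \<le> int n * int (rho B)"
proof -
  let ?J = "\<lambda>v. top_indices (U v)"
  have Uv: "fsubspace (U v)" "U v \<subseteq> {f. \<forall>i\<ge>n. f i = 0}" if "v \<in> bverts B" for v
    using familyD[OF U that] by (auto simp: const_sheaf_def)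
  have J: "?J v \<subseteq> {..<n}" "fdim (U v) = card (?J v)" if "v \<in> bverts B" for v
    using fdim_eq_card_top_indices[OF Uv[OF that]] by (blast, blast)
  have count: "int (card S) = (\<Sum>j<n. if j \<in> S then 1 else 0)" if "S \<subseteq> {..<n}" for S
    using that by (simp add: sum.If_cases Int_absorb1)
  let ?T = "\<lambda>j. {v\<in>bverts B. j \<in> ?J v}"
  have edge: "int (fdim (edge_space (const_sheaf n) e (U (btail B e)) (U (bhead B e))))
      \<le> (\<Sum>j<n. if e \<in> arcs_in B (?T j) then 1 else 0)" if e: "e \<in> barcs B" for e
  proof -
    let ?A = "U (btail B e)" and ?B = "U (bhead B e)"
    note t = wf_bigraphD(3)[OF wf e] and h = wf_bigraphD(4)[OF wf e]
    have edge_space: "edge_space (const_sheaf n) e ?A ?B = ?A \<inter> ?B"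
      using Uv(2)[OF t] by (auto simp: edge_space_def const_sheaf_def)
    have dim: "fdim (?A \<inter> ?B) = card (top_indices (?A \<inter> ?B))"
    proof -
      have "?A \<inter> ?B \<subseteq> {f. \<forall>i\<ge>n. f i = 0}"
        using Uv(2)[OF t] by (rule le_infI1)
      then show ?thesis
        using fdim_eq_card_top_indices fsubspace_Int[OF Uv(1)[OF t] Uv(1)[OF h]] by blast
    qed
    \<comment> \<open>A pivot of the intersection is a pivot of both spaces. The converse can fail,
      since the witnessing vectors may differ, but an upper bound suffices.\<close>
    have "top_indices (?A \<inter> ?B) \<subseteq> top_indices ?A \<inter> top_indices ?B"
      by (auto simp: top_indices_def)
    then have le: "card (top_indices (?A \<inter> ?B)) \<le> card (top_indices ?A \<inter> top_indices ?B)"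
      using J(1)[OF t] by (intro card_mono) (auto intro: finite_subset)
    have eq: "int (card (top_indices ?A \<inter> top_indices ?B))
        = (\<Sum>j<n. if e \<in> arcs_in B (?T j) then 1 else 0)"
      using J(1)[OF t] e t h by (subst count) (auto simp: arcs_in_def intro!: sum.cong)
    show ?thesis
      unfolding edge_space dim by (rule order_trans[OF of_nat_mono[OF le] eq_refl[OF eq]])
  qed
  have "excess B (const_sheaf n) U \<le> (\<Sum>e\<in>barcs B. \<Sum>j<n. if e \<in> arcs_in B (?T j) then 1 else 0)
      - (\<Sum>v\<in>bverts B. \<Sum>j<n. if v \<in> ?T j then 1 else 0)"
    unfolding excess_def
  proof (rule diff_mono)
    show "(\<Sum>e\<in>barcs B. int (fdim (edge_space (const_sheaf n) e (U (btail B e)) (U (bhead B e)))))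
      \<le> (\<Sum>e\<in>barcs B. \<Sum>j<n. if e \<in> arcs_in B (?T j) then 1 else 0)"
      using edge by (rule sum_mono)
    show "(\<Sum>v\<in>bverts B. \<Sum>j<n. if v \<in> ?T j then 1 else 0) \<le> (\<Sum>v\<in>bverts B. int (fdim (U v)))"
      using J count by (intro sum_mono) simp
  qed
  also have "\<dots> = (\<Sum>j<n. int (card (arcs_in B (?T j))) - int (card (?T j)))"
  proof -
    have "(\<Sum>e\<in>barcs B. if e \<in> arcs_in B (?T j) then 1 else 0) = int (card (arcs_in B (?T j)))" for j
      using wf_bigraphD(2)[OF wf] by (simp add: sum.If_cases arcs_in_def Int_def)
    moreover have "(\<Sum>v\<in>bverts B. if v \<in> ?T j then 1 else 0) = int (card (?T j))" for j
      using wf_bigraphD(1)[OF wf] by (simp add: sum.If_cases Int_def)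
    ultimately show ?thesis
      by (subst (1 2) sum.swap) (simp add: sum_subtractf)
  qed
  also have "\<dots> \<le> (\<Sum>j<n. int (rho B))"
    using excess_le_rho[OF wf] by (intro sum_mono) auto
  finally show ?thesis
    by simp
qed

lemma edge_space_const_sheaf: "edge_space (const_sheaf n) e S T = {w\<in>S \<inter> T. \<forall>i\<ge>n. w i = 0}"
  by (auto simp: edge_space_def const_sheaf_def)

text \<open>Edge spaces of the constant sheaf do not mention the arc, so swapping the factors
  changes nothing. The product then becomes a Galois covering of \<open>C\<close> with group
  \<open>G\<close>, and the bound for the constant sheaf on \<open>C\<close> applies.\<close>

lemma excess_pull_const_sheaf:
  assumes wf: "wf_bigraph C"
    and G: "group G" "finite (carrier G)" "g1 \<in> carrier G" "g2 \<in> carrier G"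
    and U: "family (fprod (cayley G g1 g2) C) (pull (const_sheaf n)) U"
  shows "excess (fprod (cayley G g1 g2) C) (pull (const_sheaf n)) U
    \<le> int (card (carrier G)) * (int n * int (rho C))"
proof -
  let ?W = "\<lambda>p. U (prod.swap p)"
  let ?P = "fprod (cayley G g1 g2) C" and ?Q = "fprod C (cayley G g1 g2)"
  have gam_pull: "edge_space (pull (const_sheaf n)) p S T = {w\<in>S \<inter> T. \<forall>i\<ge>n. w i = 0}"
    for p :: "'x \<times> 'y" and S T :: "(nat \<Rightarrow> 'e) set"
    by (cases p) (simp add: edge_space_const_sheaf)
  have "family ?Q (pull (const_sheaf n)) ?W"
    using U by (auto simp: family_def const_sheaf_def)
  then have "excess ?Q (pull (const_sheaf n)) ?W \<le> int (card (carrier G)) * (int n * int (rho C))"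
    by (intro excess_Galois[OF wf is_sheaf_const G excess_const_sheaf[OF wf]])
  moreover have "excess ?P (pull (const_sheaf n)) U = excess ?Q (pull (const_sheaf n)) ?W"
  proof -
    have "(\<Sum>p\<in>barcs ?P. int (fdim {w\<in>U (btail ?P p) \<inter> U (bhead ?P p). \<forall>i\<ge>n. w i = 0}))
      = (\<Sum>p\<in>barcs ?Q. int (fdim {w\<in>?W (btail ?Q p) \<inter> ?W (bhead ?Q p). \<forall>i\<ge>n. w i = 0}))"
      by (intro sum.reindex_bij_witness[of _ prod.swap prod.swap]) auto
    moreover have "(\<Sum>p\<in>bverts ?P. int (fdim (U p))) = (\<Sum>p\<in>bverts ?Q. int (fdim (?W p)))"
      by (intro sum.reindex_bij_witness[of _ prod.swap prod.swap]) auto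
    ultimately show ?thesis
      unfolding excess_def gam_pull by simp
  qed
  ultimately show ?thesis
    by simp
qed

section \<open>The translates of a subgraph\<close>

text \<open>Double counting of pairs \<open>(p,x)\<close> with \<open>f x p \<in> T\<close>: every
  \<open>x\<close> sees one full copy of \<open>T\<close>.\<close>

lemma sum_card_fibres:
  assumes "finite A" "finite X" "\<And>x. x \<in> X \<Longrightarrow> bij_betw (f x) {p\<in>A. f x p \<in> T} T"
  shows "(\<Sum>p\<in>A. card {x\<in>X. f x p \<in> T}) = card X * card T"
proof -
  have "(\<Sum>p\<in>A. card {x\<in>X. f x p \<in> T}) = (\<Sum>p\<in>A. \<Sum>x\<in>X. if f x p \<in> T then 1 else 0)"
    using assms(2) by (simp add: sum.If_cases Int_def)
  also have "\<dots> = (\<Sum>x\<in>X. \<Sum>p\<in>A. if f x p \<in> T then 1 else 0)"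
    by (rule sum.swap)
  also have "\<dots> = (\<Sum>x\<in>X. card {p\<in>A. f x p \<in> T})"
    using assms(1) by (simp add: sum.If_cases Int_def)
  also have "\<dots> = (\<Sum>x\<in>X. card T)"
    using assms(3) by (intro sum.cong refl bij_betw_same_card)
  finally show ?thesis
    by simp
qed

lemma dsums_UNIV:
  assumes "finite X"
  shows "fin_dim (dsums X (\<lambda>_. UNIV :: (unit \<Rightarrow> 'k::field) set))"
    "fdim (dsums X (\<lambda>_. UNIV :: (unit \<Rightarrow> 'k::field) set)) = card X"
  using dim_dsums[OF assms, of "\<lambda>_. UNIV :: (unit \<Rightarrow> 'k) set"]
  by (simp_all add: fin_dim_UNIV_unit fdim_UNIV_unit)

lemma dsums_UNIV_iff:
  "u \<in> dsums X (\<lambda>_. UNIV :: (unit \<Rightarrow> 'k::field) set) \<longleftrightarrow> (\<forall>x. x \<notin> X \<longrightarrow> u (x,()) = 0)"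
  by (auto simp: dsums_def fun_eq_iff)

text \<open>The coordinate \<open>x\<close> of the direct sum lives on the translate
  \<open>Lx\<close>, whose product with \<open>C\<close> is a copy of \<open>fprod L C\<close>.
  Placing a copy of \<open>T\<close> in every coordinate yields a coordinate subspace at each
  vertex, whose dimension is counted copy by copy.\<close>

lemma translates_excess:
  fixes L :: "('g, 'g \<times> nat) bigraph" and C :: "('v,'e) bigraph"
  assumes G: "group G" "finite (carrier G)" "g1 \<in> carrier G" "g2 \<in> carrier G"
    and L: "is_subgraph L (cayley G g1 g2)" and C: "wf_bigraph C"
    and sh: "is_sheaf (cayley G g1 g2)
      (dsum (carrier G) (\<lambda>x. ind_sheaf (rtranslate G g1 g2 L x)) :: ('g, 'g \<times> nat, 'g \<times> unit, 'k::field) sheaf)"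
    and T: "T \<subseteq> bverts (fprod L C)"
  obtains U where "family (fprod (cayley G g1 g2) C)
      (pull (dsum (carrier G) (\<lambda>x. ind_sheaf (rtranslate G g1 g2 L x)) :: ('g, 'g \<times> nat, 'g \<times> unit, 'k::field) sheaf)) U"
    "int (card (carrier G)) * (int (card (arcs_in (fprod L C) T)) - int (card T))
      \<le> excess (fprod (cayley G g1 g2) C)
          (pull (dsum (carrier G) (\<lambda>x. ind_sheaf (rtranslate G g1 g2 L x)) :: ('g, 'g \<times> nat, 'g \<times> unit, 'k::field) sheaf)) U"
proof -
  interpret group G by fact
  let ?X = "carrier G" and ?B = "cayley G g1 g2"
  define P where "P = fprod ?B C"
  define A :: "('g, 'g \<times> nat, 'g \<times> unit, 'k) sheaf"
    where "A = dsum ?X (\<lambda>x. ind_sheaf (rtranslate G g1 g2 L x))"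
  define PA :: "('g \<times> 'v, ('g \<times> nat) \<times> 'e, 'g \<times> unit, 'k) sheaf" where "PA = pull A"
  have wfB: "wf_bigraph ?B"
    using G by (rule wf_cayley)
  have wfP: "wf_bigraph P"
    unfolding P_def using wfB C by (rule wf_fprod)
  have sP: "is_sheaf P PA"
    unfolding P_def PA_def A_def using sh by (rule is_sheaf_pull)
  have Lv: "bverts L \<subseteq> ?X" and La: "barcs L \<subseteq> ?X \<times> {1,2}"
    and Le: "\<And>e. e \<in> barcs L \<Longrightarrow> btail L e = btail ?B e \<and> bhead L e = bhead ?B e \<and> bcol L e = bcol ?B e"
    using L by (auto simp: is_subgraph_def)
  define E where "E = arcs_in (fprod L C) T"
  \<comment> \<open>\<open>f x\<close> and \<open>k x\<close> undo the translation by
    \<open>x\<close> on vertices and arcs, so \<open>f x p \<in> T\<close> says that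
    \<open>p\<close> lies in the copy of \<open>T\<close> with index \<open>x\<close>.\<close>
  define f where "f x = (\<lambda>(g,v::'v). (g \<otimes>\<^bsub>G\<^esub> inv\<^bsub>G\<^esub> x, v))" for x
  define k where "k x = (\<lambda>((g,i::nat),y::'e). ((g \<otimes>\<^bsub>G\<^esub> inv\<^bsub>G\<^esub> x, i), y))" for x
  define U where "U p = dsums {x\<in>?X. f x p \<in> T} (\<lambda>_. UNIV :: (unit \<Rightarrow> 'k) set)" for p
  have fP: "finite (bverts P)" "finite (barcs P)"
    using wf_bigraphD[OF wfP] by auto
  \<comment> \<open>Right translation commutes with left multiplication by the generators, so
    \<open>f x\<close> sends the ends of \<open>p\<close> to the ends of
    \<open>k x p\<close>.\<close>
  have kE: "f x (btail P p) \<in> T" "f x (bhead P p) \<in> T" "(fst (k x p)) \<in> barcs L"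
    if p: "p \<in> barcs P" and x: "x \<in> ?X" and k: "k x p \<in> E" for x p
  proof -
    obtain g i y where [simp]: "p = ((g,i),y)"
      by (cases p) auto
    have gi: "g \<in> ?X" "i \<in> {1,2}"
      using p by (auto simp: P_def)
    have e: "(g \<otimes>\<^bsub>G\<^esub> inv\<^bsub>G\<^esub> x, i) \<in> barcs L"
      using k by (simp add: k_def E_def arcs_in_def)
    then show "(fst (k x p)) \<in> barcs L"
      by (simp add: k_def)
    show "f x (btail P p) \<in> T" "f x (bhead P p) \<in> T"
      using k Le[OF e] gi x G(3,4) by (auto simp: k_def E_def arcs_in_def f_def P_def m_assoc)
  qed
  have famU: "family P PA U"
    unfolding family_def
  proof (intro ballI conjI)
    fix p assume "p \<in> bverts P"
    then obtain g v where p: "p = (g,v)" "g \<in> ?X"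
      by (auto simp: P_def)
    show "fsubspace (U p)"
      unfolding U_def by (intro fsubspace_dsums) simp
    show "U p \<subseteq> sv PA p"
    proof
      fix u assume "u \<in> U p"
      then have u: "u (x,()) = 0" if "x \<notin> {x\<in>?X. f x p \<in> T}" for x
        using that by (simp add: U_def dsums_UNIV_iff)
      have "(\<lambda>i. u (x,i)) \<in> (if x \<in> ?X then sv (ind_sheaf (rtranslate G g1 g2 L x)) g else {0})" for x
      proof (cases "x \<in> ?X \<and> f x p \<in> T")
        case True
        then have "g \<otimes>\<^bsub>G\<^esub> inv\<^bsub>G\<^esub> x \<in> bverts L"
          using T p by (auto simp: f_def)
        moreover have "g = (g \<otimes>\<^bsub>G\<^esub> inv\<^bsub>G\<^esub> x) \<otimes>\<^bsub>G\<^esub> x"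
          using True p(2) by (simp add: m_assoc)
        ultimately have "g \<in> bverts (rtranslate G g1 g2 L x)"
          by (simp add: rtranslate_def)
        then show ?thesis
          using True by (simp add: ind_sheaf_def)
      next
        case False
        then have "(\<lambda>i. u (x,i)) = 0"
          using u[of x] by (auto simp: fun_eq_iff)
        then show ?thesis
          by (simp add: ind_sheaf_def)
      qed
      then show "u \<in> sv PA p"
        by (simp add: p(1) PA_def A_def dsum_def)
    qed
  qed
  have gamU: "dsums {x\<in>?X. k x p \<in> E} (\<lambda>_. UNIV) \<subseteq> edge_space PA p (U (btail P p)) (U (bhead P p))"
    if p: "p \<in> barcs P" for p
  proof
    fix w :: "'g \<times> unit \<Rightarrow> 'k" assume "w \<in> dsums {x\<in>?X. k x p \<in> E} (\<lambda>_. UNIV)"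
    then have w: "w (x,()) = 0" if "x \<notin> {x\<in>?X. k x p \<in> E}" for x
      using that by (simp add: dsums_UNIV_iff)
    obtain e y where py: "p = (e,y)"
      by (cases p)
    have e: "e \<in> ?X \<times> {1,2}"
      using p by (simp add: P_def py)
    have "(\<lambda>i. w (x,i)) \<in> (if x \<in> ?X then se (ind_sheaf (rtranslate G g1 g2 L x)) e else {0})" for x
    proof (cases "x \<in> ?X \<and> k x p \<in> E")
      case True
      obtain g i where gi: "e = (g,i)" "g \<in> ?X"
        using e by auto
      have "(g \<otimes>\<^bsub>G\<^esub> inv\<^bsub>G\<^esub> x, i) \<in> barcs L"
        using kE(3)[OF p] True by (simp add: py gi(1) k_def)
      moreover have "(g,i) = ((g \<otimes>\<^bsub>G\<^esub> inv\<^bsub>G\<^esub> x) \<otimes>\<^bsub>G\<^esub> x, i)"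
        using True gi(2) by (simp add: m_assoc)
      ultimately have "e \<in> barcs (rtranslate G g1 g2 L x)"
        unfolding gi(1) by (force simp: rtranslate_def)
      then show ?thesis
        using True by (simp add: ind_sheaf_def)
    next
      case False
      then have "(\<lambda>i. w (x,i)) = 0"
        using w[of x] by (auto simp: fun_eq_iff)
      then show ?thesis
        by (simp add: ind_sheaf_def)
    qed
    then have 1: "w \<in> se PA p"
      by (simp add: py PA_def A_def dsum_def)
    \<comment> \<open>Restriction acts coordinatewise, so it cannot enlarge the support of
      \<open>w\<close>; by \<open>kE\<close> that support is admissible at both ends.\<close>
    have rt: "rt PA p w (x,()) = 0" and rh: "rh PA p w (x,()) = 0"
      if "w (x,()) = 0" for x
      using that by (simp_all add: py PA_def A_def dsum_def ind_sheaf_def)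
    have "rt PA p w \<in> U (btail P p)" "rh PA p w \<in> U (bhead P p)"
      unfolding U_def dsums_UNIV_iff using rt rh w kE(1,2)[OF p] by blast+
    with 1 show "w \<in> edge_space PA p (U (btail P p)) (U (bhead P p))"
      by (simp add: edge_space_def)
  qed
  have edge: "card {x\<in>?X. k x p \<in> E} \<le> fdim (edge_space PA p (U (btail P p)) (U (bhead P p)))"
    if p: "p \<in> barcs P" for p
  proof -
    have "fin_dim (edge_space PA p (U (btail P p)) (U (bhead P p)))"
      by (intro fin_dim_edge_space[OF sP p] familyD(1)[OF famU] wf_bigraphD(3,4)[OF wfP p])
    then have "fdim (dsums {x\<in>?X. k x p \<in> E} (\<lambda>_. UNIV :: (unit \<Rightarrow> 'k) set))
        \<le> fdim (edge_space PA p (U (btail P p)) (U (bhead P p)))"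
      using gamU[OF p] by (rule fdim_mono)
    then show ?thesis
      using G(2) by (simp add: dsums_UNIV)
  qed
  have "(\<Sum>p\<in>bverts P. fdim (U p)) = (\<Sum>p\<in>bverts P. card {x\<in>?X. f x p \<in> T})"
    using G(2) by (simp add: U_def dsums_UNIV)
  also have "\<dots> = card ?X * card T"
  proof (rule sum_card_fibres[OF fP(1) G(2)])
    fix x assume x: "x \<in> ?X"
    show "bij_betw (f x) {p\<in>bverts P. f x p \<in> T} T"
      using x T Lv
      by (intro bij_betwI[of _ _ _ "\<lambda>(g,v). (g \<otimes>\<^bsub>G\<^esub> x, v)"]) (auto simp: f_def P_def m_assoc subset_iff)
  qed
  finally have vert: "(\<Sum>p\<in>bverts P. fdim (U p)) = card ?X * card T" .
  have "card ?X * card E = (\<Sum>p\<in>barcs P. card {x\<in>?X. k x p \<in> E})"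
  proof (rule sum_card_fibres[OF fP(2) G(2), symmetric])
    fix x assume x: "x \<in> ?X"
    \<comment> \<open>\<open>L\<close> inherits its colours from the Cayley bigraph, so the label
      \<open>i\<close> equals the colour of \<open>y\<close>; hence translating an arc of
      \<open>E\<close> by \<open>x\<close> gives an arc of \<open>P\<close>.\<close>
    have E: "g \<in> ?X \<and> i \<in> {1,2} \<and> y \<in> barcs C \<and> bcol C y = i" if "((g,i),y) \<in> E" for g i y
    proof -
      have "(g,i) \<in> barcs L"
        using that by (simp add: E_def arcs_in_def)
      then show ?thesis
        using that La Le[of "(g,i)"] by (auto simp: E_def arcs_in_def)
    qed
    show "bij_betw (k x) {p\<in>barcs P. k x p \<in> E} E"
      using x E
      by (intro bij_betwI[of _ _ _ "\<lambda>((g,i),y). ((g \<otimes>\<^bsub>G\<^esub> x, i), y)"]) (auto simp: k_def P_def m_assoc)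
  qed
  also have "\<dots> \<le> (\<Sum>p\<in>barcs P. fdim (edge_space PA p (U (btail P p)) (U (bhead P p))))"
    using edge by (rule sum_mono)
  finally have "int (card ?X * card E) \<le> int (\<Sum>p\<in>barcs P. fdim (edge_space PA p (U (btail P p)) (U (bhead P p))))"
    by (rule of_nat_mono)
  moreover have "(\<Sum>p\<in>bverts P. int (fdim (U p))) = int (card ?X * card T)"
    unfolding vert[symmetric] by simp
  ultimately have "int (card ?X) * (int (card E) - int (card T)) \<le> excess P PA U"
    unfolding excess_def by (simp add: right_diff_distrib)
  then show ?thesis
    using famU that unfolding P_def PA_def A_def E_def by blast
qed

theorem theorem2:
  fixes G :: "'g monoid" and g1 g2 :: 'g
    and L :: "('g, 'g \<times> nat) bigraph"
    and K :: "('g, 'g \<times> nat, 'i, 'k::field) sheaf"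
    and \<alpha> :: "('g, 'g \<times> nat, 'i, 'g \<times> unit, 'k) sheaf_map"
    and \<beta> :: "('g, 'g \<times> nat, 'g \<times> unit, nat, 'k) sheaf_map"
    and L' :: "('v2, 'e2) bigraph"
  assumes "group G" and "finite (carrier G)"
    and "g1 \<in> carrier G" and "g2 \<in> carrier G"
    and "is_subgraph L (cayley G g1 g2)"
    and "short_exact (cayley G g1 g2) K
           (dsum (carrier G) (\<lambda>x. ind_sheaf (rtranslate G g1 g2 L x)))
           (const_sheaf (rho L)) \<alpha> \<beta>"
    and "max_excess (cayley G g1 g2) K = 0"
    and "wf_bigraph L'" and "etale L'"
  shows "rho (fprod L L') \<le> rho L * rho L'"
proof -
  let ?B = "cayley G g1 g2"
  let ?P = "fprod ?B L'"
  let ?A = "dsum (carrier G) (\<lambda>x. ind_sheaf (rtranslate G g1 g2 L x))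
    :: ('g, 'g \<times> nat, 'g \<times> unit, 'k) sheaf"
  let ?C = "const_sheaf (rho L) :: ('g, 'g \<times> nat, nat, 'k) sheaf"
  note G = assms(1-4) and ex = assms(6)
  have wfB: "wf_bigraph ?B"
    using G by (rule wf_cayley)
  have wfP: "wf_bigraph ?P"
    using wfB assms(8) by (rule wf_fprod)
  have wfL: "wf_bigraph L"
    using wfB assms(5) by (auto simp: wf_bigraph_def is_subgraph_def intro: finite_subset)
  have sK: "is_sheaf ?B K" and sA: "is_sheaf ?B ?A"
    using ex by (simp_all add: short_exact_def)
  obtain T where T: "T \<subseteq> bverts (fprod L L')"
    "int (card (arcs_in (fprod L L') T)) - int (card T) = int (rho (fprod L L'))"
    using excess_attains_rho[OF wf_fprod[OF wfL assms(8)]] .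
  obtain U where U: "family ?P (pull ?A) U"
    "int (card (carrier G)) * int (rho (fprod L L')) \<le> excess ?P (pull ?A) U"
    using translates_excess[OF G assms(5,8) sA T(1)] unfolding T(2) .
  obtain U1 U3 where U13: "family ?P (pull K) U1" "family ?P (pull ?C) U3"
    "excess ?P (pull ?A) U \<le> excess ?P (pull K) U1 + excess ?P (pull ?C) U3"
    by (rule excess_short_exact[OF wfP short_exact_pull[OF ex] U(1)])
  have "excess ?B K W \<le> 0" if "family ?B K W" for W
    using excess_le_max_excess[OF wfB sK that] assms(7) by simp
  then have "excess ?P (pull K) U1 \<le> 0"
    by (rule excess_etale_pullback[OF wfB sK assms(8,9) _ U13(1)])
  moreover have "excess ?P (pull ?C) U3
      \<le> int (card (carrier G)) * (int (rho L) * int (rho L'))"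
    by (rule excess_pull_const_sheaf[OF assms(8) G U13(2)])
  ultimately have "int (card (carrier G)) * int (rho (fprod L L'))
      \<le> int (card (carrier G)) * int (rho L * rho L')"
    using U(2) U13(3) by simp
  \<comment> \<open>The factor on the left counts translates, the one on the right is the degree of
    the covering of \<open>L'\<close>; being positive, it cancels.\<close>
  moreover have "card (carrier G) > 0"
    using G(1,2) group.is_monoid monoid.one_closed by (auto simp: card_gt_0_iff)
  ultimately show ?thesis
    by (metis mult_le_cancel_left_pos of_nat_0_less_iff of_nat_le_iff)
qed

end
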